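(* Let $G$ be a discrete group, let $(X,G)$ be a tame $G$-flow and let $\mu\in\operatorname{Erg}_G(X)$. Then $\operatorname{supp}(\mu)$ is a minimal subflow of $X$.
   Context: All compact spaces are Hausdorff (no metrizability is assumed) and all probability measures on compact spaces are regular Borel measures. A $G$-flow $(X,G)$ is a compact space $X$ with an action of the discrete group $G$ by homeomorphisms; a subflow is a nonempty closed $G$-invariant subset; a (sub)flow is minimal if every orbit in it is dense in it. $\operatorname{Prob}_G(X)$ is the convex set of $G$-invariant regular Borel probability measures on $X$, and $\operatorname{Erg}_G(X)$ is the set of its extreme points (ergodic measures). The enveloping semigroup $E(X,G)$ is the closure of $\{g_X:g\in G\}$ in $X^X$ with the product topology, where $g_X(x)=gx$. A map $f:X\to Y$ from a compact space to a uniform space is fragmented if for every nonempty $A\subseteq X$ and every entourage $V$ of $Y$ there is a nonempty relatively open $U\subseteq A$ with $(f(x),f(y))\in V$ for all $x,y\in U$. The flow $(X,G)$ is tame if every element of $E(X,G)$ is a fragmented map $X\to X$ (with $X$ carrying its unique compatible uniformity). *)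

theory Defs
  imports "HOL-Probability.Probability" "HOL-Algebra.Group_Action"
begin

text \<open>The phase space is a type. Its class \<open>uniform_space\<close> provides a uniformity inducing
  the topology; since the space is assumed compact Hausdorff, such a uniformity exists and is
  unique, so it is no additional datum. With carrier \<open>UNIV\<close>, the locale
  \<open>group_action\<close> says that \<open>\<phi>\<close> is a homomorphism into the group of all bijections
  of the phase space. \<open>G\<close> carries no topology, that is, it is discrete.\<close>

locale flow = group_action G "UNIV :: 'x set" \<phi>
  for G :: "('g, 'm) monoid_scheme" (structure)
    and \<phi> :: "'g \<Rightarrow> 'x::{t2_space, uniform_space} \<Rightarrow> 'x" +
  assumes compact_phase_space: "compact (UNIV :: 'x set)"
    and homeomorphism_action:
      "g \<in> carrier G \<Longrightarrow> homeomorphism UNIV UNIV (\<phi> g) (\<phi> (inv\<^bsub>G\<^esub> g))"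

definition subflow ::
    "('g, 'm) monoid_scheme \<Rightarrow> ('g \<Rightarrow> 'x::topological_space \<Rightarrow> 'x) \<Rightarrow> 'x set \<Rightarrow> bool" where
  "subflow G \<phi> Y \<longleftrightarrow> Y \<noteq> {} \<and> closed Y \<and> (\<forall>g\<in>carrier G. \<phi> g ` Y \<subseteq> Y)"

definition minimal_subflow ::
    "('g, 'm) monoid_scheme \<Rightarrow> ('g \<Rightarrow> 'x::topological_space \<Rightarrow> 'x) \<Rightarrow> 'x set \<Rightarrow> bool" where
  "minimal_subflow G \<phi> Y \<longleftrightarrow> subflow G \<phi> Y \<and> (\<forall>y\<in>Y. Y \<subseteq> closure (orbit G \<phi> y))"

text \<open>The closure is taken in the topology of the function type, which is the product topology
  (topology of pointwise convergence).\<close>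

definition enveloping_semigroup ::
    "('g, 'm) monoid_scheme \<Rightarrow> ('g \<Rightarrow> 'x::topological_space \<Rightarrow> 'x) \<Rightarrow> ('x \<Rightarrow> 'x) set" where
  "enveloping_semigroup G \<phi> = closure (\<phi> ` carrier G)"

text \<open>Entourages are the sets \<open>V\<close> belonging to the filter \<open>uniformity\<close>.\<close>

definition fragmented :: "('a::topological_space \<Rightarrow> 'b::uniform_space) \<Rightarrow> bool" where
  "fragmented f \<longleftrightarrow>
    (\<forall>A V. A \<noteq> {} \<longrightarrow> (\<forall>\<^sub>F z in uniformity. z \<in> V) \<longrightarrow>
      (\<exists>U. U \<noteq> {} \<and> openin (top_of_set A) U \<and> (\<forall>x\<in>U. \<forall>y\<in>U. (f x, f y) \<in> V)))"

definition tame ::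
    "('g, 'm) monoid_scheme \<Rightarrow> ('g \<Rightarrow> 'x::uniform_space \<Rightarrow> 'x) \<Rightarrow> bool" where
  "tame G \<phi> \<longleftrightarrow> (\<forall>p\<in>enveloping_semigroup G \<phi>. fragmented p)"

definition regular_borel_prob :: "'x::topological_space measure \<Rightarrow> bool" where
  "regular_borel_prob \<mu> \<longleftrightarrow> prob_space \<mu> \<and> sets \<mu> = sets borel \<and>
    (\<forall>B\<in>sets borel.
      emeasure \<mu> B = (SUP K\<in>{K. K \<subseteq> B \<and> compact K}. emeasure \<mu> K) \<and>
      emeasure \<mu> B = (INF U\<in>{U. B \<subseteq> U \<and> open U}. emeasure \<mu> U))"

definition Prob_inv ::
    "('g, 'm) monoid_scheme \<Rightarrow> ('g \<Rightarrow> 'x::topological_space \<Rightarrow> 'x) \<Rightarrow> 'x measure set" where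
  "Prob_inv G \<phi> = {\<mu>. regular_borel_prob \<mu> \<and> (\<forall>g\<in>carrier G. distr \<mu> borel (\<phi> g) = \<mu>)}"

text \<open>The extreme points of \<open>Prob_inv G \<phi>\<close>. The type of measures is not a real vector space,
  so \<open>extreme_point_of\<close> does not apply; its definition is spelled out, with convex
  combinations of measures taken setwise.\<close>

definition Erg ::
    "('g, 'm) monoid_scheme \<Rightarrow> ('g \<Rightarrow> 'x::topological_space \<Rightarrow> 'x) \<Rightarrow> 'x measure set" where
  "Erg G \<phi> = {\<mu> \<in> Prob_inv G \<phi>.
    \<forall>\<nu>1\<in>Prob_inv G \<phi>. \<forall>\<nu>2\<in>Prob_inv G \<phi>. \<forall>t::real. 0 < t \<longrightarrow> t < 1 \<longrightarrow>
      (\<forall>B\<in>sets borel. measure \<mu> B = (1 - t) * measure \<nu>1 B + t * measure \<nu>2 B) \<longrightarrow>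
      \<nu>1 = \<nu>2}"

definition supp :: "'x::topological_space measure \<Rightarrow> 'x set" where
  "supp \<mu> = {x. \<forall>U. open U \<longrightarrow> x \<in> U \<longrightarrow> emeasure \<mu> U > 0}"

end

theory Submission imports Defs begin

text \<open>Write \<open>T\<close> for the group of homeomorphisms given by the action and \<open>E\<close> for its closure,
  the enveloping semigroup. The proof shows that limits of translates are invertible modulo null
  sets, and plays this off against minimal left ideals.

  Tameness makes convergence in \<open>E\<close> measure-theoretic. Let \<open>f\<close> be a continuous real function.
  If \<open>p \<mapsto> f \<circ> p\<close> were not continuous on \<open>E\<close> for convergence in measure, then along an ultrafilter
  converging to some \<open>q \<in> E\<close> the functions \<open>f \<circ> t\<close> would, after replacing \<open>f\<close> by its distance
  from a constant, be large on a non-negligible part of every relatively open subset of a suitable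
  closed set on which \<open>f \<circ> q\<close> is small. As \<open>f \<circ> t\<close> is also small somewhere in each of these
  subsets, because \<open>t\<close> tends to \<open>q\<close> pointwise, one can choose
  inductively an independent sequence of functions \<open>f \<circ> t\<close>, and every cluster point of such a
  sequence of maps fails to be fragmented
  (\<open>independent_sequence_cluster_point_not_fragmented\<close>, \<open>limit_in_measure\<close>). The closed set comes from
  the measurability of fragmented maps, in the form that compact sets of small oscillation exhaust
  the measure (\<open>fragmented_cover\<close>).

  Since \<open>\<mu>\<close> is invariant, composition on the right with an element of \<open>T\<close> does not change the distance
  in measure between \<open>f \<circ> p\<close> and \<open>f \<circ> q\<close>; by continuity neither does composition with an element
  of \<open>E\<close>. Hence \<open>v \<circ> q = q\<close> with \<open>v, q \<in> E\<close> forces \<open>f \<circ> v = f\<close> almost everywhere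
  (\<open>left_identity_AE_eq\<close>). A minimal left ideal contains such a pair, and then every point \<open>v x\<close> has
  a minimal orbit closure (\<open>exists_minimal_limit\<close>).

  Suppose now that \<open>y\<close> and \<open>z\<close> lie in the support, but \<open>z\<close> is not in the orbit closure of \<open>y\<close>, and
  separate them by a continuous \<open>f\<close> vanishing on the orbit of \<open>y\<close> with \<open>f z = 1\<close>. By ergodicity the
  orbit of almost every \<open>x\<close> meets a given open set that meets the support. So the orbit of a generic
  \<open>x\<close> reaches \<open>{f > 1/2}\<close>, but it also follows the orbit of \<open>y\<close>, where \<open>f\<close> is small, for any
  prescribed finite set of group elements. As \<open>f (t (v x)) = f (t x)\<close>, the same holds for \<open>v x\<close>. By
  compactness the orbit closure of \<open>v x\<close> contains a point along whose entire orbit \<open>f \<le> 1/3\<close>,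
  although \<open>f\<close> exceeds \<open>1/2\<close> somewhere on the orbit of \<open>v x\<close>. This contradicts minimality.

  Neither the group nor a base of the topology need be countable, whereas only countably many almost sure
  statements can be combined. Therefore the last step is run for a countable submonoid of \<open>T\<close>, built
  so that it still witnesses the recurrence statements supplied by ergodicity
  (\<open>Erg_countably_many_translates_cover\<close>, \<open>countable_submonoid_closed_under\<close>).\<close>

section \<open>Compact spaces and spaces of maps\<close>

text \<open>The Heine--Cantor theorem: it makes the sets on which \<open>f\<close> oscillates by less than \<open>e\<close>
  admissible in the definition of fragmentation, so that fragmentation of \<open>p\<close> controls
  the oscillation of \<open>f \<circ> p\<close>.\<close>
lemma continuous_imp_entourage:
  fixes f :: "'x::uniform_space \<Rightarrow> real"
  assumes "compact (UNIV :: 'x set)" and f: "continuous_on UNIV f" and "0 < e"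
  shows "\<forall>\<^sub>F z in uniformity. \<bar>f (fst z) - f (snd z)\<bar> < e"
proof -
  \<comment> \<open>By the composition axiom of uniformities the bound at \<open>x\<close> persists for chains
    \<open>x, y, z\<close> of two steps; with \<open>x\<close> ranging over the centres of a finite cover, the second step
    is the given pair.\<close>
  have "\<exists>D. eventually D uniformity \<and> (\<forall>y z. D (x, y) \<longrightarrow> D (y, z) \<longrightarrow> \<bar>f z - f x\<bar> < e / 2)" for x
  proof -
    have "open {y. dist (f y) (f x) < e / 2}"
      by (intro open_Collect_less continuous_intros f)
    then have "\<forall>\<^sub>F y in nhds x. dist (f y) (f x) < e / 2"
      unfolding eventually_nhds using \<open>0 < e\<close>
      by (intro exI[of _ "{y. dist (f y) (f x) < e / 2}"]) simp
    then have "\<forall>\<^sub>F (x', y) in uniformity. x' = x \<longrightarrow> \<bar>f y - f x\<bar> < e / 2"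
      by (simp add: eventually_nhds_uniformity dist_real_def)
    from uniformity_trans[OF this] show ?thesis by auto
  qed
  then obtain D where D: "\<And>x. eventually (D x) uniformity"
    "\<And>x y z. D x (x, y) \<Longrightarrow> D x (y, z) \<Longrightarrow> \<bar>f z - f x\<bar> < e / 2"
    by metis
  have "\<exists>U. open U \<and> x \<in> U \<and> (\<forall>y\<in>U. D x (x, y))" for x
  proof -
    have "\<forall>\<^sub>F y in nhds x. D x (x, y)"
      using D(1)[of x] by (auto simp: eventually_nhds_uniformity elim: eventually_mono)
    then show ?thesis by (auto simp: eventually_nhds)
  qed
  then obtain U where U: "\<And>x. open (U x)" "\<And>x. x \<in> U x" "\<And>x y. y \<in> U x \<Longrightarrow> D x (x, y)"
    by metis
  obtain C where C: "finite C" "UNIV \<subseteq> (\<Union>x\<in>C. U x)"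
  proof (rule compactE_image[OF assms(1), of UNIV U])
    show "UNIV \<subseteq> (\<Union>x\<in>UNIV. U x)" using U(2) by auto
  qed (use U(1) in auto)
  have "\<forall>\<^sub>F z in uniformity. \<forall>x\<in>C. D x z"
    using C(1) D(1) by (simp add: eventually_ball_finite)
  then show ?thesis
  proof (rule eventually_mono)
    fix z assume z: "\<forall>x\<in>C. D x z"
    obtain x where x: "x \<in> C" "fst z \<in> U x" using C(2) by blast
    have "D x (fst z, fst z)" using D(1) by (rule uniformity_refl)
    then have "\<bar>f (fst z) - f x\<bar> < e / 2" using D(2) U(3) x by blast
    moreover have "\<bar>f (snd z) - f x\<bar> < e / 2"
      using D(2)[of x "fst z" "snd z"] U(3)[OF x(2)] z x by simp
    ultimately show "\<bar>f (fst z) - f (snd z)\<bar> < e" by linarith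
  qed
qed

lemma compact_fun_space:
  assumes "compact (UNIV :: 'x::topological_space set)"
  shows "compact (UNIV :: ('i \<Rightarrow> 'x) set)"
proof -
  have "compact_space (euclidean :: 'x topology)"
    using assms by (simp add: compact_space_def)
  then have "compact_space (product_topology (\<lambda>_::'i. euclidean :: 'x topology) UNIV)"
    by (simp add: compact_space_product_topology)
  then show ?thesis
    by (simp add: compact_space_def euclidean_product_topology)
qed

lemma Hausdorff_space_euclidean_t2:
  "Hausdorff_space (euclidean :: 'x::t2_space topology)"
  unfolding Hausdorff_space_def
proof (intro allI impI)
  fix x y :: 'x assume "x \<in> topspace euclidean \<and> y \<in> topspace euclidean \<and> x \<noteq> y"
  then obtain U V where "open U" "open V" "x \<in> U" "y \<in> V" "U \<inter> V = {}"
    using hausdorff by metis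
  then show "\<exists>U V. openin euclidean U \<and> openin euclidean V \<and> x \<in> U \<and> y \<in> V \<and> disjnt U V"
    unfolding disjnt_def by (auto simp flip: open_openin)
qed

text \<open>Pointwise limits are unique because the product topology is Hausdorff; this is what makes the image
  of a minimal left ideal under right multiplication closed.\<close>
lemma compact_fun_imp_closed:
  fixes S :: "('i \<Rightarrow> 'x::t2_space) set"
  assumes "compact S"
  shows "closed S"
proof -
  have "Hausdorff_space (product_topology (\<lambda>_::'i. euclidean :: 'x topology) UNIV)"
    using Hausdorff_space_euclidean_t2 by (metis Hausdorff_space_product_topology)
  then have "Hausdorff_space (euclidean :: ('i \<Rightarrow> 'x) topology)"
    by (simp only: euclidean_product_topology)
  then show ?thesis
    using assms compactin_imp_closedin by (metis closed_closedin compactin_euclidean_iff)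
qed

lemma continuous_on_evaluate:
  assumes "continuous_on UNIV f"
  shows "continuous_on UNIV (\<lambda>p. f (p x))"
  using continuous_on_compose2[OF assms continuous_on_product_coordinates] by auto

lemma open_evaluate_less:
  fixes f :: "'x::topological_space \<Rightarrow> real"
  assumes "continuous_on UNIV f"
  shows "open {p. f (p x) < c}" "open {p. c < f (p x)}"
  using continuous_on_evaluate[OF assms, of x]
  by (auto intro: open_Collect_less continuous_on_const)

text \<open>Function spaces are right topological semigroups: right multiplication is always continuous, left
  multiplication only by continuous maps.\<close>
lemma continuous_on_comp_right: "continuous_on UNIV (\<lambda>p. p \<circ> q)"
  unfolding comp_def by (intro continuous_on_coordinatewise_then_product continuous_on_product_coordinates)

lemma continuous_on_comp_left:
  assumes "continuous_on UNIV t"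
  shows "continuous_on UNIV (\<lambda>p. t \<circ> p)"
  unfolding comp_def by (intro continuous_on_coordinatewise_then_product continuous_on_evaluate assms)

section \<open>Ultrafilters and minimal closed sets\<close>

text \<open>Ultrafilters are the minimal proper filters; a chain of proper filters has a proper infimum
  because the infimum of a chain is the union of the corresponding families of sets.\<close>
lemma ultrafilter_below:
  assumes "F \<noteq> bot"
  obtains U where "U \<le> F" "U \<noteq> bot" "\<And>P. eventually P U \<or> eventually (\<lambda>x. \<not> P x) U"
proof -
  define A where "A = {U. U \<le> F \<and> U \<noteq> bot}"
  have "\<exists>m\<in>A. \<forall>a\<in>A. a \<le> m \<longrightarrow> a = m"
  proof (rule predicate_Zorn)
    show "partial_order_on A (relation_of (\<lambda>x y. y \<le> x) A)"
      by (rule partial_order_on_relation_ofI) auto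
  next
    fix C assume C: "C \<in> Chains (relation_of (\<lambda>x y. y \<le> x) A)"
    then have CA: "C \<subseteq> A" and tot: "\<And>a b. a \<in> C \<Longrightarrow> b \<in> C \<Longrightarrow> a \<le> b \<or> b \<le> a"
      by (auto simp: Chains_def relation_of_def)
    show "\<exists>u\<in>A. \<forall>a\<in>C. u \<le> a"
    proof (cases "C = {}")
      case True
      then show ?thesis using assms by (auto simp: A_def)
    next
      case False
      have "eventually P (Inf C) \<longleftrightarrow> (\<exists>b\<in>C. eventually P b)" for P
        by (rule eventually_Inf_base[OF False]) (use tot in \<open>metis inf.absorb1 inf.absorb2 order_refl\<close>)
      then have "Inf C \<noteq> bot"
        using CA by (auto simp: A_def trivial_limit_def)
      moreover have "Inf C \<le> F"
        using False CA by (auto simp: A_def intro: Inf_lower2)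
      ultimately show ?thesis by (auto simp: A_def intro!: bexI[of _ "Inf C"] Inf_lower)
    qed
  qed
  then obtain U where U: "U \<in> A" "\<And>V. V \<in> A \<Longrightarrow> V \<le> U \<Longrightarrow> V = U" by blast
  have "eventually P U \<or> eventually (\<lambda>x. \<not> P x) U" for P
  proof (cases "inf U (principal {x. P x}) = bot")
    case True
    then show ?thesis
      unfolding trivial_limit_def eventually_inf_principal by simp
  next
    case False
    then have "inf U (principal {x. P x}) = U"
      using U by (auto simp: A_def intro: le_infI1)
    then have "U \<le> principal {x. P x}" by (metis inf.cobounded2)
    then show ?thesis by (simp add: le_principal)
  qed
  then show ?thesis using that U(1) by (auto simp: A_def)
qed

lemma exists_minimal_set:
  fixes P :: "'a set \<Rightarrow> bool"
  assumes "P Y0"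
    and chain: "\<And>C. C \<noteq> {} \<Longrightarrow> (\<And>Y. Y \<in> C \<Longrightarrow> P Y) \<Longrightarrow>
      (\<And>Y Z. Y \<in> C \<Longrightarrow> Z \<in> C \<Longrightarrow> Y \<subseteq> Z \<or> Z \<subseteq> Y) \<Longrightarrow> P (\<Inter>C)"
  obtains Y where "P Y" "\<And>Z. P Z \<Longrightarrow> Z \<subseteq> Y \<Longrightarrow> Z = Y"
proof -
  have "\<exists>m\<in>{Y. P Y}. \<forall>a\<in>{Y. P Y}. a \<subseteq> m \<longrightarrow> a = m"
  proof (rule predicate_Zorn)
    show "partial_order_on {Y. P Y} (relation_of (\<lambda>x y. y \<subseteq> x) {Y. P Y})"
      by (rule partial_order_on_relation_ofI) auto
  next
    fix C assume C: "C \<in> Chains (relation_of (\<lambda>x y. y \<subseteq> x) {Y. P Y})"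
    show "\<exists>u\<in>{Y. P Y}. \<forall>a\<in>C. u \<subseteq> a"
    proof (cases "C = {}")
      case True
      then show ?thesis using assms(1) by auto
    next
      case False
      have "P (\<Inter>C)"
        by (rule chain[OF False]) (use C in \<open>auto simp: Chains_def relation_of_def\<close>)
      then show ?thesis by (intro bexI[of _ "\<Inter>C"]) auto
    qed
  qed
  then show ?thesis using that by auto
qed

lemma chain_closed_Inter_meets:
  assumes "compact K"
    and "C \<noteq> {}" "\<And>Y. Y \<in> C \<Longrightarrow> closed Y" "\<And>Y. Y \<in> C \<Longrightarrow> K \<inter> Y \<noteq> {}"
    and tot: "\<And>Y Z. Y \<in> C \<Longrightarrow> Z \<in> C \<Longrightarrow> Y \<subseteq> Z \<or> Z \<subseteq> Y"
  shows "K \<inter> \<Inter>C \<noteq> {}"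
proof (rule compact_imp_fip[OF \<open>compact K\<close>])
  fix F assume F: "finite F" "F \<subseteq> C"
  have "\<exists>Y\<in>C. Y \<subseteq> \<Inter>F"
    using F
  proof (induction F)
    case empty
    then show ?case using assms(2) by auto
  next
    case (insert A F)
    then obtain Y where "Y \<in> C" "Y \<subseteq> \<Inter>F" by auto
    then show ?case using tot[of Y A] insert.prems by auto
  qed
  then show "K \<inter> \<Inter>F \<noteq> {}" using assms(4) by blast
qed (use assms in auto)

section \<open>Independent sequences and fragmentation\<close>

text \<open>By compactness every pattern \<open>I \<subseteq> \<nat>\<close> is realised by a point at which \<open>f \<circ> s i\<close> is high exactly for
  \<open>i \<in> I\<close>. Take a closed set \<open>Y\<close> that is minimal among those realising all finite patterns. Removing
  a relatively open nonempty part of \<open>Y\<close> destroys some pattern of length \<open>n\<close>, so all points of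
  \<open>Y\<close> with this initial pattern lie in the removed part. Among them are points whose later values are
  all high and points whose later values are all low, and at these \<open>f \<circ> p\<close> is at least \<open>b\<close> and at
  most \<open>a\<close>, for any cluster point \<open>p\<close> of the sequence. Hence \<open>f \<circ> p\<close> oscillates by \<open>b - a\<close> on
  every relatively open part of \<open>Y\<close>.\<close>
lemma independent_sequence_cluster_point_not_fragmented:
  fixes f :: "'x::{t2_space, uniform_space} \<Rightarrow> real" and s :: "nat \<Rightarrow> 'x \<Rightarrow> 'x"
  assumes compact: "compact (UNIV :: 'x set)"
    and f: "continuous_on UNIV f" and s: "\<And>n. continuous_on UNIV (s n)" and "a < b"
    and indep: "\<And>n I. \<exists>x. \<forall>i<n. (i \<in> I \<longrightarrow> b \<le> f (s i x)) \<and> (i \<notin> I \<longrightarrow> f (s i x) \<le> a)"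
    and p: "inf (nhds p) (filtermap s sequentially) \<noteq> bot"
  shows "\<not> fragmented p"
proof
  assume frag: "fragmented p"
  define C where "C n I = {x. \<forall>i<n. (i \<in> I \<longrightarrow> b \<le> f (s i x)) \<and> (i \<notin> I \<longrightarrow> f (s i x) \<le> a)}"
    for n :: nat and I
  have fs: "continuous_on UNIV (\<lambda>x. f (s i x))" for i
    using continuous_on_compose2[OF f s] by simp
  have closed_C: "closed (C n I)" for n I
  proof -
    have "closed {x. (i \<in> I \<longrightarrow> b \<le> f (s i x)) \<and> (i \<notin> I \<longrightarrow> f (s i x) \<le> a)}" for i
      using fs[of i] by (cases "i \<in> I") (simp_all add: closed_Collect_le)
    moreover have "C n I = (\<Inter>i\<in>{..<n}. {x. (i \<in> I \<longrightarrow> b \<le> f (s i x)) \<and> (i \<notin> I \<longrightarrow> f (s i x) \<le> a)})"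
      unfolding C_def by blast
    ultimately show ?thesis by (simp add: closed_INT)
  qed
  have C_mono: "C m I \<subseteq> C n J" if "n \<le> m" "I \<inter> {..<n} = J \<inter> {..<n}" for m n I J
  proof
    fix x assume x: "x \<in> C m I"
    have "i \<in> I \<longleftrightarrow> i \<in> J" if "i < n" for i
      using \<open>I \<inter> {..<n} = J \<inter> {..<n}\<close> that by blast
    then show "x \<in> C n J" using x \<open>n \<le> m\<close> by (simp add: C_def)
  qed
  define P where "P Y \<longleftrightarrow> closed Y \<and> (\<forall>n I. C n I \<inter> Y \<noteq> {})" for Y
  obtain Y where Y: "P Y" and Y_min: "\<And>Z. P Z \<Longrightarrow> Z \<subseteq> Y \<Longrightarrow> Z = Y"
  proof (rule exists_minimal_set[of P UNIV])
    have "C n I \<noteq> {}" for n I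
      using indep[of n I] unfolding C_def by blast
    then show "P UNIV" by (simp add: P_def)
  next
    fix \<C> assume \<C>: "\<C> \<noteq> {}" "\<And>Y. Y \<in> \<C> \<Longrightarrow> P Y" "\<And>Y Z. Y \<in> \<C> \<Longrightarrow> Z \<in> \<C> \<Longrightarrow> Y \<subseteq> Z \<or> Z \<subseteq> Y"
    have "C n I \<inter> \<Inter>\<C> \<noteq> {}" for n I
    proof (rule chain_closed_Inter_meets)
      show "compact (C n I)"
        using compact_Int_closed[OF compact closed_C] by simp
    qed (use \<C> in \<open>auto simp: P_def\<close>)
    then show "P (\<Inter>\<C>)" using \<C>(2) unfolding P_def by auto
  qed auto
  have full: "\<exists>x\<in>Y. \<forall>n. x \<in> C n I" for I
  proof -
    have "Y \<inter> (\<Inter>n\<in>UNIV. C n I) \<noteq> {}"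
    proof (rule compact_imp_fip_image)
      show "compact Y" using compact_Int_closed[OF compact, of Y] Y by (simp add: P_def)
    next
      fix N :: "nat set" assume "finite N"
      then obtain m where "\<And>n. n \<in> N \<Longrightarrow> n \<le> m" using finite_nat_set_iff_bounded_le by auto
      then have "C m I \<subseteq> (\<Inter>n\<in>N. C n I)" using C_mono by blast
      then show "Y \<inter> (\<Inter>n\<in>N. C n I) \<noteq> {}" using Y unfolding P_def by blast
    qed (rule closed_C)
    then show ?thesis by blast
  qed
  define V where "V = {z. \<bar>f (fst z) - f (snd z)\<bar> < b - a}"
  have "\<forall>\<^sub>F z in uniformity. z \<in> V"
    using continuous_imp_entourage[OF compact f, of "b - a"] \<open>a < b\<close> by (simp add: V_def)
  moreover have "Y \<noteq> {}" using Y unfolding P_def by auto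
  ultimately obtain U where U: "U \<noteq> {}" "openin (top_of_set Y) U" "\<And>x y. x \<in> U \<Longrightarrow> y \<in> U \<Longrightarrow> (p x, p y) \<in> V"
    using frag unfolding fragmented_def by meson
  then obtain O' where O': "open O'" "U = Y \<inter> O'" by (auto simp: openin_open)
  have "\<not> P (Y - O')"
    using Y_min[of "Y - O'"] U(1) O'(2) by auto
  then obtain n I where nI: "C n I \<inter> (Y - O') = {}"
    using Y O'(1) unfolding P_def by auto
  obtain x where x: "x \<in> Y" "\<And>m. x \<in> C m (I \<union> {n..})" using full by blast
  obtain y where y: "y \<in> Y" "\<And>m. y \<in> C m (I \<inter> {..<n})" using full by blast
  have "x \<in> C n I" "y \<in> C n I"
    using x(2)[of n] y(2)[of n] by (auto simp: C_def)
  then have "x \<in> U" "y \<in> U" using nI x(1) y(1) O'(2) by auto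
  then have "(p x, p y) \<in> V" by (rule U(3))
  moreover have "b \<le> f (p x)"
  proof (rule ccontr)
    assume "\<not> b \<le> f (p x)"
    then have "\<forall>\<^sub>F q in nhds p. f (q x) < b"
      unfolding eventually_nhds
      by (intro exI[of _ "{q. f (q x) < b}"]) (auto simp: open_evaluate_less[OF f])
    moreover have "b \<le> f (s i x)" if "n \<le> i" for i
      using x(2)[of "Suc i"] that by (auto simp: C_def)
    then have "\<forall>\<^sub>F q in filtermap s sequentially. \<not> f (q x) < b"
      unfolding eventually_filtermap eventually_sequentially by (force simp: not_less)
    ultimately have "\<forall>\<^sub>F q in inf (nhds p) (filtermap s sequentially). False"
      unfolding eventually_inf by blast
    then show False using p by (simp add: trivial_limit_def)
  qed
  moreover have "f (p y) \<le> a"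
  proof (rule ccontr)
    assume "\<not> f (p y) \<le> a"
    then have "\<forall>\<^sub>F q in nhds p. a < f (q y)"
      unfolding eventually_nhds
      by (intro exI[of _ "{q. a < f (q y)}"]) (auto simp: open_evaluate_less[OF f])
    moreover have "f (s i y) \<le> a" if "n \<le> i" for i
      using y(2)[of "Suc i"] that by (auto simp: C_def)
    then have "\<forall>\<^sub>F q in filtermap s sequentially. \<not> a < f (q y)"
      unfolding eventually_filtermap eventually_sequentially by (force simp: not_less)
    ultimately have "\<forall>\<^sub>F q in inf (nhds p) (filtermap s sequentially). False"
      unfolding eventually_inf by blast
    then show False using p by (simp add: trivial_limit_def)
  qed
  ultimately show False by (simp add: V_def)
qed

text \<open>If finitely many relatively open parts of \<open>S\<close> can always be split simultaneously by a single map,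
  then after \<open>n\<close> choices all \<open>2 ^ n\<close> patterns are realised on such parts, and the next map is
  chosen to split all of them.\<close>
lemma splitting_maps_independent_sequence:
  fixes f :: "'x::topological_space \<Rightarrow> real"
  assumes f: "continuous_on UNIV f" and T: "\<And>t. t \<in> T \<Longrightarrow> continuous_on UNIV t" and "S \<noteq> {}"
    and split: "\<And>\<W>. finite \<W> \<Longrightarrow> (\<And>W. W \<in> \<W> \<Longrightarrow> open W \<and> W \<inter> S \<noteq> {}) \<Longrightarrow>
      \<exists>t\<in>T. \<forall>W\<in>\<W>. (\<exists>x\<in>W \<inter> S. f (t x) < a) \<and> (\<exists>x\<in>W \<inter> S. b < f (t x))"
  obtains s :: "nat \<Rightarrow> 'x \<Rightarrow> 'x" where "\<And>n. s n \<in> T"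
    "\<And>n I. \<exists>x. \<forall>i<n. (i \<in> I \<longrightarrow> b < f (s i x)) \<and> (i \<notin> I \<longrightarrow> f (s i x) < a)"
proof -
  define D where "D n I l = {x. \<forall>i<n. (i \<in> I \<longrightarrow> b < f ((l ! i) x)) \<and> (i \<notin> I \<longrightarrow> f ((l ! i) x) < a)}"
    for n :: nat and I :: "nat set" and l :: "('x \<Rightarrow> 'x) list"
  define P where "P n l \<longleftrightarrow> length l = n \<and> set l \<subseteq> T \<and> (\<forall>I. D n I l \<inter> S \<noteq> {})" for n l
  have "P 0 []" using \<open>S \<noteq> {}\<close> by (auto simp: P_def D_def)
  moreover have "\<exists>l'. P (Suc n) l' \<and> (\<exists>t. l' = l @ [t])" if "P n l" for n l
  proof -
    have l: "length l = n" "set l \<subseteq> T" "\<And>I. D n I l \<inter> S \<noteq> {}" using that by (auto simp: P_def)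
    have openD: "open (D n I l)" for I
    proof -
      have "continuous_on UNIV (\<lambda>x. f ((l ! i) x))" if "i < n" for i
        using that l continuous_on_compose2[OF f T] by (metis nth_mem subsetD top_greatest)
      then have "open {x. (i \<in> I \<longrightarrow> b < f ((l ! i) x)) \<and> (i \<notin> I \<longrightarrow> f ((l ! i) x) < a)}" if "i < n" for i
        using that by (cases "i \<in> I") (simp_all add: open_Collect_less)
      moreover have "D n I l =
          (\<Inter>i\<in>{..<n}. {x. (i \<in> I \<longrightarrow> b < f ((l ! i) x)) \<and> (i \<notin> I \<longrightarrow> f ((l ! i) x) < a)})"
        unfolding D_def by blast
      ultimately show ?thesis by (simp add: open_INT)
    qed
    have "\<exists>t\<in>T. \<forall>W\<in>(\<lambda>I. D n I l) ` Pow {..<n}.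
        (\<exists>x\<in>W \<inter> S. f (t x) < a) \<and> (\<exists>x\<in>W \<inter> S. b < f (t x))"
    proof (rule split)
      fix W assume "W \<in> (\<lambda>I. D n I l) ` Pow {..<n}"
      then obtain I where "W = D n I l" by blast
      then show "open W \<and> W \<inter> S \<noteq> {}" using openD l(3) by simp
    qed simp
    then obtain t where "t \<in> T" and W: "\<forall>W\<in>(\<lambda>I. D n I l) ` Pow {..<n}.
        (\<exists>x\<in>W \<inter> S. f (t x) < a) \<and> (\<exists>x\<in>W \<inter> S. b < f (t x))"
      by blast
    have t: "(\<exists>x\<in>D n I l \<inter> S. f (t x) < a) \<and> (\<exists>x\<in>D n I l \<inter> S. b < f (t x))"
      if "I \<subseteq> {..<n}" for I
      using W that by blast
    have "D (Suc n) I (l @ [t]) \<inter> S \<noteq> {}" for I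
    proof -
      have *: "D n (I \<inter> {..<n}) l = D n I l" by (auto simp: D_def)
      have "\<exists>x\<in>D n I l \<inter> S. (n \<in> I \<longrightarrow> b < f (t x)) \<and> (n \<notin> I \<longrightarrow> f (t x) < a)"
        using t[of "I \<inter> {..<n}"] unfolding * by blast
      then obtain x where x: "x \<in> S" "x \<in> D n I l"
        "(n \<in> I \<longrightarrow> b < f (t x)) \<and> (n \<notin> I \<longrightarrow> f (t x) < a)" by blast
      have "x \<in> D (Suc n) I (l @ [t])"
        unfolding D_def mem_Collect_eq
      proof (intro allI impI)
        fix i assume "i < Suc n"
        then consider "i < n" | "i = n" by linarith
        then show "(i \<in> I \<longrightarrow> b < f (((l @ [t]) ! i) x)) \<and> (i \<notin> I \<longrightarrow> f (((l @ [t]) ! i) x) < a)"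
          by cases (use x l(1) in \<open>simp_all add: D_def nth_append\<close>)
      qed
      then show ?thesis using x(1) by blast
    qed
    then have "P (Suc n) (l @ [t])" using l \<open>t \<in> T\<close> by (simp add: P_def)
    then show ?thesis by blast
  qed
  ultimately obtain L where L: "\<And>n. P n (L n)" "\<And>n. \<exists>t. L (Suc n) = L n @ [t]"
    using dependent_nat_choice[of P "\<lambda>n l l'. \<exists>t. l' = l @ [t]"] by metis
  define s where "s i = L (Suc i) ! i" for i
  have nth: "L n ! i = s i" if "i < n" for n i
    using that
  proof (induction n)
    case (Suc n)
    obtain t where "L (Suc n) = L n @ [t]" using L(2) by blast
    moreover have "length (L n) = n" using L(1) by (simp add: P_def)
    ultimately show ?case using Suc by (cases "i = n") (auto simp: s_def nth_append)
  qed simp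
  show ?thesis
  proof
    show "s n \<in> T" for n
      using L(1)[of "Suc n"] unfolding s_def P_def by (metis lessI nth_mem subsetD)
    show "\<exists>x. \<forall>i<n. (i \<in> I \<longrightarrow> b < f (s i x)) \<and> (i \<notin> I \<longrightarrow> f (s i x) < a)" for n I
    proof -
      obtain x where "x \<in> D n I (L n)" using L(1)[of n] unfolding P_def by blast
      then show ?thesis using nth[of _ n] unfolding D_def by auto
    qed
  qed
qed

lemma compact_sequence_cluster_point:
  fixes s :: "nat \<Rightarrow> 'a::topological_space"
  assumes "compact (UNIV :: 'a set)" "\<And>n. s n \<in> T"
  obtains p where "inf (nhds p) (filtermap s sequentially) \<noteq> bot" "p \<in> closure T"
proof -
  have "filtermap s sequentially \<noteq> bot"
    by (simp add: filtermap_bot_iff)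
  then obtain p where p: "inf (nhds p) (filtermap s sequentially) \<noteq> bot"
    using compact_filter[THEN iffD1, OF assms(1), rule_format, of "filtermap s sequentially"] by auto
  have "p \<in> closure T"
    unfolding closure_iff_nhds_not_empty
  proof (intro allI impI notI)
    fix A W assume "W \<subseteq> A" "open W" "p \<in> W" "T \<inter> A = {}"
    then have "\<forall>\<^sub>F q in nhds p. q \<notin> T" by (auto simp: eventually_nhds)
    moreover have "\<forall>\<^sub>F q in filtermap s sequentially. q \<in> T"
      using assms(2) by (simp add: eventually_filtermap)
    ultimately have "\<forall>\<^sub>F q in inf (nhds p) (filtermap s sequentially). False"
      unfolding eventually_inf by blast
    then show False using p by (simp add: trivial_limit_def)
  qed
  with p show ?thesis by (rule that)
qed

section \<open>Regular measures and fragmented maps\<close>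

lemma regular_borel_probD:
  assumes "regular_borel_prob \<mu>"
  shows "prob_space \<mu>" "sets \<mu> = sets borel" "space \<mu> = UNIV" "measure \<mu> UNIV = 1"
proof -
  show *: "prob_space \<mu>" "sets \<mu> = sets borel"
    using assms by (auto simp: regular_borel_prob_def)
  then show "space \<mu> = UNIV" using sets_eq_imp_space_eq by fastforce
  then show "measure \<mu> UNIV = 1" using prob_space.prob_space[OF *(1)] by simp
qed

lemma regular_inner_approx:
  fixes \<mu> :: "'x::t2_space measure"
  assumes "regular_borel_prob \<mu>" "B \<in> sets borel" "0 < e"
  obtains K where "K \<subseteq> B" "compact K" "measure \<mu> (B - K) < e"
proof -
  interpret prob_space \<mu> using assms regular_borel_probD by blast
  note [simp] = regular_borel_probD(2)[OF assms(1)]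
  show ?thesis
  proof (cases "measure \<mu> B < e")
    case True
    then show ?thesis using that[of "{}"] by simp
  next
    case False
    have "ennreal (measure \<mu> B - e) < emeasure \<mu> B"
      using False \<open>0 < e\<close> by (simp add: emeasure_eq_measure ennreal_less_iff)
    also have "emeasure \<mu> B = (SUP K\<in>{K. K \<subseteq> B \<and> compact K}. emeasure \<mu> K)"
      using assms by (simp add: regular_borel_prob_def)
    finally obtain K where K: "K \<subseteq> B" "compact K" "ennreal (measure \<mu> B - e) < emeasure \<mu> K"
      by (auto simp: less_SUP_iff)
    then have "measure \<mu> B - e < measure \<mu> K"
      using False by (simp add: emeasure_eq_measure ennreal_less_iff)
    moreover have "measure \<mu> (B - K) = measure \<mu> B - measure \<mu> K"
      using K assms by (intro finite_measure_Diff) (auto simp: borel_closed compact_imp_closed)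
    ultimately show ?thesis using that K by simp
  qed
qed

text \<open>A relative of the support. The upper limit along \<open>F\<close> of the numbers \<open>measure \<mu> (B \<inter> Z t)\<close> is
  subadditive in \<open>B\<close> and at most \<open>measure \<mu> B\<close>. By inner regularity of \<open>\<mu>\<close>, a Borel set is
  therefore negligible in the limit as soon as all its compact subsets are. Consequently the union
  of all relatively open subsets of \<open>K\<close> that are negligible in the limit is again negligible, and
  none of the relatively open nonempty subsets of its complement \<open>S\<close> in \<open>K\<close> is. If \<open>Z t\<close> is
  always the whole space and \<open>F\<close> is proper, \<open>S\<close> is the support of the restriction of \<open>\<mu>\<close> to
  \<open>K\<close>.\<close>
lemma asymptotic_kernel:
  fixes \<mu> :: "'x::t2_space measure" and Z :: "'t \<Rightarrow> 'x set"
  assumes reg: "regular_borel_prob \<mu>" and Z: "\<And>t. Z t \<in> sets borel" and K: "compact K"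
    and nonnull: "\<not> ((\<lambda>t. measure \<mu> (K \<inter> Z t)) \<longlongrightarrow> 0) F"
  obtains S where "S \<subseteq> K" "compact S" "S \<noteq> {}"
    "\<And>W. open W \<Longrightarrow> W \<inter> S \<noteq> {} \<Longrightarrow> \<not> ((\<lambda>t. measure \<mu> (W \<inter> S \<inter> Z t)) \<longlongrightarrow> 0) F"
proof -
  interpret prob_space \<mu> using reg regular_borel_probD by blast
  note [simp] = regular_borel_probD(2)[OF reg] and [measurable] = Z
  have K_meas[measurable]: "K \<in> sets borel" using K by (simp add: borel_closed compact_imp_closed)
  define null where "null B \<longleftrightarrow> ((\<lambda>t. measure \<mu> (B \<inter> Z t)) \<longlongrightarrow> 0) F" for B
  have null_iff: "null B \<longleftrightarrow> (\<forall>e>0. \<forall>\<^sub>F t in F. measure \<mu> (B \<inter> Z t) < e)" for B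
    unfolding null_def tendsto_iff by simp
  have null_mono: "null A" if "null B" "A \<subseteq> B" and [measurable]: "B \<in> sets borel" for A B
    unfolding null_iff
  proof (intro allI impI)
    fix e :: real assume "0 < e"
    then have "\<forall>\<^sub>F t in F. measure \<mu> (B \<inter> Z t) < e" using that by (simp add: null_iff)
    then show "\<forall>\<^sub>F t in F. measure \<mu> (A \<inter> Z t) < e"
    proof (rule eventually_mono)
      fix t assume "measure \<mu> (B \<inter> Z t) < e"
      moreover have "measure \<mu> (A \<inter> Z t) \<le> measure \<mu> (B \<inter> Z t)"
        using that by (intro finite_measure_mono) auto
      ultimately show "measure \<mu> (A \<inter> Z t) < e" by simp
    qed
  qed
  have null_Un: "null (A \<union> B)" if "null A" "null B"
    and [measurable]: "A \<in> sets borel" "B \<in> sets borel" for A B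
    unfolding null_iff
  proof (intro allI impI)
    fix e :: real assume "0 < e"
    then have "\<forall>\<^sub>F t in F. measure \<mu> (A \<inter> Z t) < e / 2 \<and> measure \<mu> (B \<inter> Z t) < e / 2"
      using that(1,2) unfolding null_iff by (intro eventually_conj) (metis half_gt_zero)+
    then show "\<forall>\<^sub>F t in F. measure \<mu> ((A \<union> B) \<inter> Z t) < e"
    proof (rule eventually_mono)
      fix t assume *: "measure \<mu> (A \<inter> Z t) < e / 2 \<and> measure \<mu> (B \<inter> Z t) < e / 2"
      have "measure \<mu> ((A \<union> B) \<inter> Z t) \<le> measure \<mu> (A \<inter> Z t) + measure \<mu> (B \<inter> Z t)"
        unfolding Int_Un_distrib2 by (intro measure_Un_le) auto
      then show "measure \<mu> ((A \<union> B) \<inter> Z t) < e" using * by linarith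
    qed
  qed
  have null_UN: "null (\<Union>x\<in>C. A x)" if "finite C" "\<And>x. x \<in> C \<Longrightarrow> null (A x) \<and> A x \<in> sets borel"
    for C :: "'x set" and A
    using that
  proof (induction C)
    case empty
    then show ?case by (simp add: null_def)
  next
    case (insert x C)
    then show ?case by (auto intro!: null_Un)
  qed
  define S where "S = {x\<in>K. \<forall>W. open W \<longrightarrow> x \<in> W \<longrightarrow> \<not> null (W \<inter> K)}"
  define O' where "O' = \<Union>{W. open W \<and> null (W \<inter> K)}"
  have S: "S = K - O'" and "open O'" by (auto simp: S_def O'_def)
  then have [measurable]: "S \<in> sets borel" by (simp add: borel_open)
  have "compact S" using K \<open>open O'\<close> unfolding S by (rule compact_diff)
  have "null (K - S)"
    unfolding null_iff
  proof (intro allI impI)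
    fix e :: real assume "0 < e"
    then obtain L where L: "L \<subseteq> K - S" "compact L" "measure \<mu> (K - S - L) < e / 2"
      using regular_inner_approx[OF reg, of "K - S" "e / 2"] by auto
    have [measurable]: "L \<in> sets borel" using L by (simp add: borel_closed compact_imp_closed)
    have "\<exists>W. open W \<and> x \<in> W \<and> null (W \<inter> K)" if "x \<in> L" for x
      using that L(1) by (auto simp: S_def)
    then obtain W where W: "\<And>x. x \<in> L \<Longrightarrow> open (W x) \<and> x \<in> W x \<and> null (W x \<inter> K)" by metis
    obtain C where C: "C \<subseteq> L" "finite C" "L \<subseteq> (\<Union>x\<in>C. W x)"
    proof (rule compactE_image[OF L(2), of L W])
      show "L \<subseteq> (\<Union>x\<in>L. W x)" using W by auto
    qed (use W in auto)
    have "null (\<Union>x\<in>C. W x \<inter> K)"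
      using W C by (intro null_UN) (auto simp: borel_open)
    moreover have "L \<subseteq> (\<Union>x\<in>C. W x \<inter> K)" using C(3) L(1) by auto
    moreover have "(\<Union>x\<in>C. W x \<inter> K) \<in> sets borel"
      using W C by (intro sets.finite_UN) (auto simp: borel_open)
    ultimately have "null L" by (rule null_mono)
    then have "\<forall>\<^sub>F t in F. measure \<mu> (L \<inter> Z t) < e / 2"
      unfolding null_iff using \<open>0 < e\<close> by (metis half_gt_zero)
    then show "\<forall>\<^sub>F t in F. measure \<mu> ((K - S) \<inter> Z t) < e"
    proof (rule eventually_mono)
      fix t assume *: "measure \<mu> (L \<inter> Z t) < e / 2"
      have "measure \<mu> ((K - S) \<inter> Z t) \<le> measure \<mu> ((L \<inter> Z t) \<union> (K - S - L))"
        by (intro finite_measure_mono) auto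
      also have "\<dots> \<le> measure \<mu> (L \<inter> Z t) + measure \<mu> (K - S - L)"
        by (intro measure_Un_le) auto
      finally show "measure \<mu> ((K - S) \<inter> Z t) < e" using * L(3) by linarith
    qed
  qed
  have nonnull_W: "\<not> null (W \<inter> S)" if "open W" "W \<inter> S \<noteq> {}" for W
  proof
    assume "null (W \<inter> S)"
    then have "null ((W \<inter> S) \<union> (K - S))"
      using \<open>null (K - S)\<close> that by (intro null_Un) (auto simp: borel_open)
    then have "null (W \<inter> K)"
      using that by (rule_tac null_mono) (auto simp: borel_open)
    then show False using that by (auto simp: S_def)
  qed
  have "S \<noteq> {}"
  proof
    assume "S = {}"
    then show False using \<open>null (K - S)\<close> nonnull by (simp add: null_def)
  qed
  show ?thesis
    by (rule that[of S]) (use \<open>compact S\<close> \<open>S \<noteq> {}\<close> nonnull_W in \<open>auto simp: S_def null_def\<close>)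
qed

text \<open>A countable union of members realises the supremum of the measures. If its complement had positive
  measure, a member inside the complement, joined to a member of almost maximal measure, would
  exceed the supremum.\<close>
lemma exhaustion_by_directed_family:
  assumes "prob_space \<mu>" and sub: "\<A> \<subseteq> sets \<mu>" and "{} \<in> \<A>"
    and Un: "\<And>A B. A \<in> \<A> \<Longrightarrow> B \<in> \<A> \<Longrightarrow> A \<union> B \<in> \<A>"
    and pos: "\<And>B. B \<in> sets \<mu> \<Longrightarrow> 0 < measure \<mu> B \<Longrightarrow> \<exists>A\<in>\<A>. A \<subseteq> B \<and> 0 < measure \<mu> A"
    and "0 < e"
  obtains A where "A \<in> \<A>" "1 - e < measure \<mu> A"
proof -
  interpret prob_space \<mu> by fact
  define s where "s = Sup (measure \<mu> ` \<A>)"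
  have bdd: "bdd_above (measure \<mu> ` \<A>)" by (rule bdd_aboveI[of _ 1]) auto
  have le_s: "measure \<mu> A \<le> s" if "A \<in> \<A>" for A
    unfolding s_def using that bdd by (intro cSup_upper) auto
  have "\<exists>A\<in>\<A>. s - d < measure \<mu> A" if "0 < d" for d
    using less_cSupD[of "measure \<mu> ` \<A>" "s - d"] \<open>{} \<in> \<A>\<close> that unfolding s_def by fastforce
  then have "\<forall>n. \<exists>A\<in>\<A>. s - inverse (real (Suc n)) < measure \<mu> A" by simp
  then obtain A where A: "\<And>n. A n \<in> \<A>" "\<And>n. s - inverse (real (Suc n)) < measure \<mu> (A n)"
    by metis
  define B where "B n = (\<Union>i\<le>n. A i)" for n
  have B: "B n \<in> \<A>" for n
  proof (induction n)
    case (Suc n)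
    have "B (Suc n) = B n \<union> A (Suc n)" by (auto simp: B_def le_Suc_eq)
    then show ?case using Suc A(1) Un by simp
  qed (simp add: B_def A(1))
  have "(\<lambda>n. measure \<mu> (B n)) \<longlonglongrightarrow> measure \<mu> (\<Union>n. B n)"
  proof (rule finite_Lim_measure_incseq)
    show "range B \<subseteq> sets \<mu>" using B sub by auto
    show "incseq B" unfolding B_def incseq_def by (auto intro: order_trans)
  qed
  then have "measure \<mu> (\<Union>n. B n) \<le> s"
    by (rule LIMSEQ_le_const2) (use le_s B in auto)
  have B_meas: "(\<Union>n. B n) \<in> sets \<mu>" using B sub by auto
  show ?thesis
  proof (cases "1 - e < s")
    case True
    then show ?thesis using less_cSupD[of "measure \<mu> ` \<A>" "1 - e"] \<open>{} \<in> \<A>\<close> that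
      unfolding s_def by fastforce
  next
    case False
    then have "0 < measure \<mu> (space \<mu> - (\<Union>n. B n))"
      using prob_compl[OF B_meas] \<open>measure \<mu> (\<Union>n. B n) \<le> s\<close> \<open>0 < e\<close> by simp
    then obtain D where D: "D \<in> \<A>" "D \<subseteq> space \<mu> - (\<Union>n. B n)" "0 < measure \<mu> D"
      using pos B_meas by blast
    obtain n where n: "inverse (real (Suc n)) < measure \<mu> D"
      using reals_Archimedean[OF D(3)] by blast
    have "A n \<inter> D = {}" using D(2) by (auto simp: B_def)
    then have "measure \<mu> (A n \<union> D) = measure \<mu> (A n) + measure \<mu> D"
      using A(1) D(1) sub by (intro finite_measure_Union) auto
    moreover have "measure \<mu> (A n \<union> D) \<le> s" using le_s Un A(1) D(1) by blast
    ultimately show ?thesis using A(2)[of n] n by linarith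
  qed
qed

text \<open>Fragmentation is applied to a compact set in which relatively open nonempty sets have positive
  measure; the part of small oscillation that it provides is then not a null set.\<close>
lemma fragmented_positive_piece:
  fixes h :: "'x::t2_space \<Rightarrow> 'y::uniform_space"
  assumes reg: "regular_borel_prob \<mu>" and "fragmented h" and "\<forall>\<^sub>F z in uniformity. z \<in> V"
    and "B \<in> sets borel" "0 < measure \<mu> B"
  obtains K where "compact K" "K \<subseteq> B" "0 < measure \<mu> K" "\<forall>x\<in>K. \<forall>y\<in>K. (h x, h y) \<in> V"
proof -
  interpret prob_space \<mu> using reg regular_borel_probD by blast
  note [simp] = regular_borel_probD(2)[OF reg]
  have positive_compact: "\<exists>K. compact K \<and> K \<subseteq> A \<and> 0 < measure \<mu> K"
    if A: "A \<in> sets borel" "0 < measure \<mu> A" for A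
  proof -
    obtain K where K: "K \<subseteq> A" "compact K" "measure \<mu> (A - K) < measure \<mu> A"
      using regular_inner_approx[OF reg A(1) A(2)] .
    moreover have "measure \<mu> (A - K) = measure \<mu> A - measure \<mu> K"
      using K A by (intro finite_measure_Diff) (auto simp: borel_closed compact_imp_closed)
    ultimately show ?thesis by auto
  qed
  obtain L where L: "compact L" "L \<subseteq> B" "0 < measure \<mu> L"
    using positive_compact assms by blast
  obtain S where S: "S \<subseteq> L" "compact S" "S \<noteq> {}"
    "\<And>W. open W \<Longrightarrow> W \<inter> S \<noteq> {} \<Longrightarrow> \<not> ((\<lambda>t. measure \<mu> (W \<inter> S \<inter> UNIV)) \<longlongrightarrow> 0) sequentially"
  proof (rule asymptotic_kernel[OF reg _ L(1), of "\<lambda>_. UNIV" sequentially])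
    show "\<not> ((\<lambda>t. measure \<mu> (L \<inter> UNIV)) \<longlongrightarrow> 0) sequentially"
      using L(3) by (simp add: LIMSEQ_const_iff)
  qed auto
  obtain U where U: "U \<noteq> {}" "openin (top_of_set S) U" "\<forall>x\<in>U. \<forall>y\<in>U. (h x, h y) \<in> V"
    using assms S(3) unfolding fragmented_def by meson
  then obtain W where W: "open W" "U = W \<inter> S" by (auto simp: openin_open)
  have "measure \<mu> U \<noteq> 0" using S(4)[OF W(1)] U(1) W(2) by auto
  moreover have "U \<in> sets borel"
    using W S(2) by (simp add: borel_open borel_closed compact_imp_closed)
  ultimately obtain K where "compact K" "K \<subseteq> U" "0 < measure \<mu> K"
    using positive_compact by (metis measure_nonneg order_le_less)
  then show ?thesis using that[of K] U(3) W S(1) L(2) by blast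
qed

text \<open>The form of measurability of fragmented maps that is used below: up to small measure the space
  consists of finitely many compact sets on which the map is almost constant.\<close>
lemma fragmented_cover:
  fixes h :: "'x::t2_space \<Rightarrow> 'y::uniform_space"
  assumes reg: "regular_borel_prob \<mu>" and h: "fragmented h" "\<forall>\<^sub>F z in uniformity. z \<in> V" and "0 < e"
  obtains \<K> where "finite \<K>" "\<And>K. K \<in> \<K> \<Longrightarrow> compact K \<and> (\<forall>x\<in>K. \<forall>y\<in>K. (h x, h y) \<in> V)"
    "1 - e < measure \<mu> (\<Union>\<K>)"
proof -
  note [simp] = regular_borel_probD(2)[OF reg]
  define Small where "Small = {K. compact K \<and> (\<forall>x\<in>K. \<forall>y\<in>K. (h x, h y) \<in> V)}"
  obtain A where "A \<in> Union ` {\<K>. finite \<K> \<and> \<K> \<subseteq> Small}" "1 - e < measure \<mu> A"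
  proof (rule exhaustion_by_directed_family[OF regular_borel_probD(1)[OF reg] _ _ _ _ \<open>0 < e\<close>,
        of "Union ` {\<K>. finite \<K> \<and> \<K> \<subseteq> Small}"])
    show "Union ` {\<K>. finite \<K> \<and> \<K> \<subseteq> Small} \<subseteq> sets \<mu>"
      by (auto simp: Small_def borel_closed compact_imp_closed intro!: sets.finite_Union)
    show "{} \<in> Union ` {\<K>. finite \<K> \<and> \<K> \<subseteq> Small}"
      by (rule image_eqI[of _ _ "{}"]) auto
  next
    fix A B assume "A \<in> Union ` {\<K>. finite \<K> \<and> \<K> \<subseteq> Small}" "B \<in> Union ` {\<K>. finite \<K> \<and> \<K> \<subseteq> Small}"
    then obtain \<K> \<L> where "A = \<Union>\<K>" "B = \<Union>\<L>" "finite \<K>" "\<K> \<subseteq> Small" "finite \<L>" "\<L> \<subseteq> Small" by auto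
    then show "A \<union> B \<in> Union ` {\<K>. finite \<K> \<and> \<K> \<subseteq> Small}"
      by (intro image_eqI[of _ _ "\<K> \<union> \<L>"]) auto
  next
    fix B assume "B \<in> sets \<mu>" "0 < measure \<mu> B"
    then obtain K where "compact K" "K \<subseteq> B" "0 < measure \<mu> K" "\<forall>x\<in>K. \<forall>y\<in>K. (h x, h y) \<in> V"
      using fragmented_positive_piece[OF reg h] by auto
    then show "\<exists>A\<in>Union ` {\<K>. finite \<K> \<and> \<K> \<subseteq> Small}. A \<subseteq> B \<and> 0 < measure \<mu> A"
      by (intro bexI[of _ K] image_eqI[of _ _ "{K}"]) (auto simp: Small_def)
  qed
  then show ?thesis using that by (auto simp: Small_def)
qed

section \<open>Convergence in measure in the enveloping semigroup\<close>

text \<open>Distance at most \<open>e\<close> between \<open>f \<circ> p\<close> and \<open>f \<circ> q\<close> in the Ky Fan metric of convergence in measure.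
  The exceptional set is only required to be contained in a Borel set, because limits of
  continuous maps need not be Borel measurable.\<close>
definition ky_fan_close :: "'x::topological_space measure \<Rightarrow> ('x \<Rightarrow> real) \<Rightarrow> real \<Rightarrow> ('x \<Rightarrow> 'x) \<Rightarrow> ('x \<Rightarrow> 'x) \<Rightarrow> bool" where
  "ky_fan_close \<mu> f e p q \<longleftrightarrow>
    (\<exists>B\<in>sets borel. measure \<mu> B \<le> e \<and> (\<forall>x. x \<notin> B \<longrightarrow> \<bar>f (p x) - f (q x)\<bar> \<le> e))"

lemma ky_fan_close_sym: "ky_fan_close \<mu> f e p q \<Longrightarrow> ky_fan_close \<mu> f e q p"
  by (simp add: ky_fan_close_def abs_minus_commute)

lemma ky_fan_close_trans:
  assumes "regular_borel_prob \<mu>" "ky_fan_close \<mu> f d p q" "ky_fan_close \<mu> f e q r"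
  shows "ky_fan_close \<mu> f (d + e) p r"
proof -
  interpret prob_space \<mu> using assms regular_borel_probD by blast
  note [simp] = regular_borel_probD(2)[OF assms(1)]
  obtain A B where AB: "A \<in> sets borel" "B \<in> sets borel" "measure \<mu> A \<le> d" "measure \<mu> B \<le> e"
    "\<And>x. x \<notin> A \<Longrightarrow> \<bar>f (p x) - f (q x)\<bar> \<le> d" "\<And>x. x \<notin> B \<Longrightarrow> \<bar>f (q x) - f (r x)\<bar> \<le> e"
    using assms unfolding ky_fan_close_def by blast
  have "measure \<mu> (A \<union> B) \<le> d + e"
    using measure_Un_le[of A \<mu> B] AB(1-4) by simp
  moreover have "\<bar>f (p x) - f (r x)\<bar> \<le> d + e" if "x \<notin> A \<union> B" for x
    using AB(5)[of x] AB(6)[of x] that by simp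
  ultimately show ?thesis unfolding ky_fan_close_def using AB(1,2) by (intro bexI[of _ "A \<union> B"]) auto
qed

lemma ky_fan_close_all_imp_AE_eq:
  assumes reg: "regular_borel_prob \<mu>" and near: "\<And>e. 0 < e \<Longrightarrow> ky_fan_close \<mu> f e p q"
  shows "AE x in \<mu>. f (p x) = f (q x)"
proof -
  interpret prob_space \<mu> using assms regular_borel_probD by blast
  note [simp] = regular_borel_probD(2)[OF reg]
  have "\<forall>n. ky_fan_close \<mu> f ((1/2)^n) p q" using near by simp
  then obtain B where B: "\<And>n. B n \<in> sets borel" "\<And>n. measure \<mu> (B n) \<le> (1/2)^n"
    "\<And>n x. x \<notin> B n \<Longrightarrow> \<bar>f (p x) - f (q x)\<bar> \<le> (1/2)^n"
    unfolding ky_fan_close_def by metis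
  have "AE x in \<mu>. \<forall>\<^sub>F n in sequentially. x \<in> space \<mu> - B n"
  proof (rule borel_cantelli_AE1)
    show "summable (\<lambda>n. measure \<mu> (B n))"
      by (rule summable_comparison_test'[of "\<lambda>n. (1/2)^n"]) (use B(2) in auto)
  qed (use B(1) in \<open>auto simp: emeasure_eq_measure\<close>)
  then show ?thesis
  proof (rule AE_mp, intro AE_I2 impI)
    fix x assume "\<forall>\<^sub>F n in sequentially. x \<in> space \<mu> - B n"
    then have "\<forall>\<^sub>F n in sequentially. \<bar>f (p x) - f (q x)\<bar> \<le> (1/2)^n"
      by (rule eventually_mono) (use B(3) in auto)
    moreover have "(\<lambda>n. (1/2::real)^n) \<longlonglongrightarrow> 0" by (simp add: LIMSEQ_power_zero)
    ultimately have "\<bar>f (p x) - f (q x)\<bar> \<le> 0"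
      by (intro tendsto_le[OF sequentially_bot _ tendsto_const])
    then show "f (p x) = f (q x)" by simp
  qed
qed

lemma eventually_nhds_evaluate:
  fixes f :: "'x::topological_space \<Rightarrow> real"
  assumes "continuous_on UNIV f"
  shows "f (q x) < c \<Longrightarrow> \<forall>\<^sub>F p in nhds q. f (p x) < c"
  unfolding eventually_nhds
  using open_evaluate_less(1)[OF assms] by (intro exI[of _ "{p. f (p x) < c}"]) simp

text \<open>The contrapositive of the two lemmas on independent sequences, combined with compactness of the
  space of maps, which provides the cluster point.\<close>
lemma no_splitting_of_fragmented_limits:
  fixes f :: "'x::{t2_space, uniform_space} \<Rightarrow> real" and T :: "('x \<Rightarrow> 'x) set"
  assumes "compact (UNIV :: 'x set)" and f: "continuous_on UNIV f"
    and T: "\<And>t. t \<in> T \<Longrightarrow> continuous_on UNIV t" and frag: "\<And>p. p \<in> closure T \<Longrightarrow> fragmented p"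
    and "a < b" "S \<noteq> {}"
  obtains \<W> where "finite \<W>" "\<And>W. W \<in> \<W> \<Longrightarrow> open W \<and> W \<inter> S \<noteq> {}"
    "\<And>t. t \<in> T \<Longrightarrow> \<exists>W\<in>\<W>. (\<forall>x\<in>W \<inter> S. a \<le> f (t x)) \<or> (\<forall>x\<in>W \<inter> S. f (t x) \<le> b)"
proof (rule ccontr)
  assume "\<not> thesis"
  note no_family = that \<open>\<not> thesis\<close>
  have split: "\<exists>t\<in>T. \<forall>W\<in>\<W>. (\<exists>x\<in>W \<inter> S. f (t x) < a) \<and> (\<exists>x\<in>W \<inter> S. b < f (t x))"
    if \<W>: "finite \<W>" "\<And>W. W \<in> \<W> \<Longrightarrow> open W \<and> W \<inter> S \<noteq> {}" for \<W>
  proof (rule ccontr)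
    assume "\<not> ?thesis"
    then have "\<exists>W\<in>\<W>. (\<forall>x\<in>W \<inter> S. a \<le> f (t x)) \<or> (\<forall>x\<in>W \<inter> S. f (t x) \<le> b)" if "t \<in> T" for t
      using that by (meson not_less)
    then show False
      using no_family(1)[OF \<W>] no_family(2) by blast
  qed
  obtain s :: "nat \<Rightarrow> 'x \<Rightarrow> 'x" where s: "\<And>n. s n \<in> T"
    "\<And>n I. \<exists>x. \<forall>i<n. (i \<in> I \<longrightarrow> b < f (s i x)) \<and> (i \<notin> I \<longrightarrow> f (s i x) < a)"
  proof (rule splitting_maps_independent_sequence[OF f T \<open>S \<noteq> {}\<close> split])
    fix s :: "nat \<Rightarrow> 'x \<Rightarrow> 'x" assume "\<And>n. s n \<in> T"
      "\<And>n I. \<exists>x. \<forall>i<n. (i \<in> I \<longrightarrow> b < f (s i x)) \<and> (i \<notin> I \<longrightarrow> f (s i x) < a)"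
    then show ?thesis by (rule that)
  qed
  obtain p where p: "inf (nhds p) (filtermap s sequentially) \<noteq> bot" "p \<in> closure T"
    using compact_sequence_cluster_point[of s T, OF compact_fun_space[OF assms(1)] s(1)] .
  have "\<not> fragmented p"
  proof (rule independent_sequence_cluster_point_not_fragmented[OF assms(1) f _ \<open>a < b\<close> _ p(1)])
    show "continuous_on UNIV (s n)" for n using T s(1) by blast
    show "\<exists>x. \<forall>i<n. (i \<in> I \<longrightarrow> b \<le> f (s i x)) \<and> (i \<notin> I \<longrightarrow> f (s i x) \<le> a)" for n I
      using s(2)[of n I] by (meson less_imp_le)
  qed
  then show False using frag p(2) by blast
qed

lemma nhds_closure_neq_bot:
  assumes "q \<in> closure T"
  shows "inf (nhds q) (principal T) \<noteq> bot"
proof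
  assume "inf (nhds q) (principal T) = bot"
  then have "\<forall>\<^sub>F p in nhds q. p \<notin> T"
    by (simp add: trivial_limit_def eventually_inf_principal)
  then obtain W where "open W" "q \<in> W" "\<forall>p\<in>W. p \<notin> T" by (auto simp: eventually_nhds)
  then show False using assms unfolding closure_iff_nhds_not_empty by blast
qed

text \<open>If the claim fails, an ultrafilter on the maps far from \<open>q\<close> converges to \<open>q\<close>. On one of finitely
  many compact sets \<open>K\<close> exhausting most of the measure, \<open>f \<circ> q\<close> is nearly a constant \<open>c K\<close> while
  \<open>f \<circ> t\<close> is far from it on a part \<open>K \<inter> Z K t\<close> whose measure does not tend to \<open>0\<close>. On the
  corresponding kernel \<open>S\<close>, every relatively open nonempty part contains points where
  \<open>\<bar>f \<circ> t - c K\<bar>\<close> is large, by construction of the kernel, and points where it is small, by pointwise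
  convergence. Along an ultrafilter this happens simultaneously for finitely many parts, which
  contradicts \<open>no_splitting_of_fragmented_limits\<close>.\<close>
lemma limit_in_measure:
  fixes f :: "'x::{t2_space, uniform_space} \<Rightarrow> real"
  assumes compact: "compact (UNIV :: 'x set)" and reg: "regular_borel_prob \<mu>"
    and f: "continuous_on UNIV f"
    and T: "\<And>t. t \<in> T \<Longrightarrow> continuous_on UNIV t" and frag: "\<And>p. p \<in> closure T \<Longrightarrow> fragmented p"
    and q: "q \<in> closure T" and "0 < e"
  shows "\<forall>\<^sub>F t in inf (nhds q) (principal T). ky_fan_close \<mu> f e t q"
proof (rule ccontr)
  interpret prob_space \<mu> using reg regular_borel_probD by blast
  note [simp] = regular_borel_probD(2)[OF reg]
  assume not_near: "\<not> ?thesis"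
  define F where "F = inf (nhds q) (principal {t\<in>T. \<not> ky_fan_close \<mu> f e t q})"
  have "F \<noteq> bot"
    using not_near unfolding F_def trivial_limit_def eventually_inf_principal by simp
  then obtain \<U> where \<U>: "\<U> \<le> F" "\<U> \<noteq> bot" "\<And>P. eventually P \<U> \<or> eventually (\<lambda>x. \<not> P x) \<U>"
    by (rule ultrafilter_below) blast
  have ev_T: "\<forall>\<^sub>F t in \<U>. t \<in> T \<and> \<not> ky_fan_close \<mu> f e t q"
    by (rule filter_leD[OF \<U>(1)]) (auto simp: F_def eventually_inf_principal)
  have ev_nhds: "eventually P \<U>" if "eventually P (nhds q)" for P
    by (rule filter_leD[OF \<U>(1)]) (use that in \<open>auto simp: F_def eventually_inf_principal elim: eventually_mono\<close>)
  define V where "V = {z. \<bar>f (fst z) - f (snd z)\<bar> < e / 4}"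
  have V: "\<forall>\<^sub>F z in uniformity. z \<in> V"
    using continuous_imp_entourage[OF compact f, of "e / 4"] \<open>0 < e\<close> by (simp add: V_def)
  obtain \<K> where \<K>: "finite \<K>" "\<And>K. K \<in> \<K> \<Longrightarrow> compact K \<and> (\<forall>x\<in>K. \<forall>y\<in>K. (q x, q y) \<in> V)"
    "1 - e / 2 < measure \<mu> (\<Union>\<K>)"
    using fragmented_cover[OF reg frag[OF q] V, of "e / 2"] \<open>0 < e\<close> by auto
  define c where "c K = f (q (SOME x. x \<in> K))" for K
  have c: "\<bar>f (q x) - c K\<bar> < e / 4" if "K \<in> \<K>" "x \<in> K" for K x
    using \<K>(2)[OF that(1)] that(2) someI[of "\<lambda>x. x \<in> K" x] by (auto simp: V_def c_def)
  \<comment> \<open>For \<open>t\<close> in \<open>T\<close> the set is open already; the interior makes \<open>Z K t\<close> a Borel set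
    for every map \<open>t\<close>.\<close>
  define Z where "Z K t = interior {x. 3 / 4 * e < \<bar>f (t x) - c K\<bar>}" for K and t :: "'x \<Rightarrow> 'x"
  have Z: "Z K t = {x. 3 / 4 * e < \<bar>f (t x) - c K\<bar>}" if "t \<in> T" for K t
    unfolding Z_def
  proof (rule interior_open)
    have "continuous_on UNIV (\<lambda>x. f (t x))" using continuous_on_compose2[OF f T[OF that]] by simp
    then show "open {x. 3 / 4 * e < \<bar>f (t x) - c K\<bar>}"
      by (intro open_Collect_less continuous_intros)
  qed
  have Z_meas: "Z K t \<in> sets borel" for K t by (simp add: Z_def borel_open)
  have K_meas: "K \<in> sets borel" if "K \<in> \<K>" for K
    using \<K>(2)[OF that] by (simp add: borel_closed compact_imp_closed)
  have "\<exists>K\<in>\<K>. \<not> ((\<lambda>t. measure \<mu> (K \<inter> Z K t)) \<longlongrightarrow> 0) \<U>"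
  proof (rule ccontr)
    assume "\<not> ?thesis"
    then have "((\<lambda>t. \<Sum>K\<in>\<K>. measure \<mu> (K \<inter> Z K t)) \<longlongrightarrow> 0) \<U>"
      by (intro tendsto_null_sum) auto
    then have "\<forall>\<^sub>F t in \<U>. (\<Sum>K\<in>\<K>. measure \<mu> (K \<inter> Z K t)) < e / 2"
      using \<open>0 < e\<close> by (intro order_tendstoD(2)[where a = "e / 2"]) auto
    then have "\<forall>\<^sub>F t in \<U>. False"
      using ev_T
    proof eventually_elim
      case (elim t)
      define B where "B = (UNIV - \<Union>\<K>) \<union> (\<Union>K\<in>\<K>. K \<inter> Z K t)"
      have meas: "\<Union>\<K> \<in> sets borel" "(\<Union>K\<in>\<K>. K \<inter> Z K t) \<in> sets borel"
        using \<K>(1) K_meas Z_meas by (auto intro!: sets.finite_Union sets.finite_UN)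
      have "measure \<mu> (UNIV - \<Union>\<K>) < e / 2"
        using \<K>(3) prob_compl[of "\<Union>\<K>"] meas regular_borel_probD(3)[OF reg] by simp
      moreover have "measure \<mu> (\<Union>K\<in>\<K>. K \<inter> Z K t) \<le> (\<Sum>K\<in>\<K>. measure \<mu> (K \<inter> Z K t))"
        using \<K>(1) K_meas Z_meas by (intro finite_measure_subadditive_finite) auto
      moreover have "measure \<mu> B \<le> measure \<mu> (UNIV - \<Union>\<K>) + measure \<mu> (\<Union>K\<in>\<K>. K \<inter> Z K t)"
        unfolding B_def using meas by (intro measure_Un_le) auto
      ultimately have "measure \<mu> B \<le> e" using elim by linarith
      moreover have "\<bar>f (t x) - f (q x)\<bar> \<le> e" if "x \<notin> B" for x
      proof -
        obtain K where K: "K \<in> \<K>" "x \<in> K" "x \<notin> Z K t" using \<open>x \<notin> B\<close> by (auto simp: B_def)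
        then have "\<bar>f (t x) - c K\<bar> \<le> 3 / 4 * e" using Z elim by auto
        then show ?thesis using c[OF K(1,2)] by linarith
      qed
      moreover have "B \<in> sets borel" unfolding B_def using meas by auto
      ultimately have "ky_fan_close \<mu> f e t q" unfolding ky_fan_close_def by blast
      then show ?case using elim by blast
    qed
    then show False using \<U>(2) by (simp add: trivial_limit_def)
  qed
  then obtain K where K: "K \<in> \<K>" "\<not> ((\<lambda>t. measure \<mu> (K \<inter> Z K t)) \<longlongrightarrow> 0) \<U>" by blast
  obtain S where S: "S \<subseteq> K" "S \<noteq> {}"
    "\<And>W. open W \<Longrightarrow> W \<inter> S \<noteq> {} \<Longrightarrow> \<not> ((\<lambda>t. measure \<mu> (W \<inter> S \<inter> Z K t)) \<longlongrightarrow> 0) \<U>"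
  proof (rule asymptotic_kernel[OF reg Z_meas _ K(2)])
    show "compact K" using \<K>(2)[OF K(1)] by blast
  next
    fix S assume "S \<subseteq> K" "S \<noteq> {}"
      "\<And>W. open W \<Longrightarrow> W \<inter> S \<noteq> {} \<Longrightarrow> \<not> ((\<lambda>t. measure \<mu> (W \<inter> S \<inter> Z K t)) \<longlongrightarrow> 0) \<U>"
    then show ?thesis by (rule that)
  qed
  \<comment> \<open>Passing to the distance from \<open>c K\<close> treats deviations of both signs at once.\<close>
  define f' where "f' y = \<bar>f y - c K\<bar>" for y
  have f': "continuous_on UNIV f'" unfolding f'_def by (intro continuous_intros f)
  obtain \<W> where \<W>: "finite \<W>" "\<And>W. W \<in> \<W> \<Longrightarrow> open W \<and> W \<inter> S \<noteq> {}"
    "\<And>t. t \<in> T \<Longrightarrow> \<exists>W\<in>\<W>. (\<forall>x\<in>W \<inter> S. e / 2 \<le> f' (t x)) \<or> (\<forall>x\<in>W \<inter> S. f' (t x) \<le> 3 / 4 * e)"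
  proof (rule no_splitting_of_fragmented_limits[OF compact f' T frag])
    show "e / 2 < 3 / 4 * e" using \<open>0 < e\<close> by simp
  qed (use S(2) in blast)+
  have "\<forall>\<^sub>F t in \<U>. (\<exists>x\<in>W \<inter> S. f' (t x) < e / 2) \<and> (\<exists>x\<in>W \<inter> S. 3 / 4 * e < f' (t x))" if W: "W \<in> \<W>" for W
  proof (rule eventually_conj)
    obtain x where x: "x \<in> W \<inter> S" using \<W>(2)[OF W] by blast
    then have "f' (q x) < e / 2" using c[OF K(1), of x] S(1) \<open>0 < e\<close> by (auto simp: f'_def)
    then have "\<forall>\<^sub>F t in \<U>. f' (t x) < e / 2"
      by (intro ev_nhds eventually_nhds_evaluate[OF f'])
    then show "\<forall>\<^sub>F t in \<U>. \<exists>x\<in>W \<inter> S. f' (t x) < e / 2"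
      by (rule eventually_mono) (use x in blast)
  next
    have "\<not> (\<forall>\<^sub>F t in \<U>. W \<inter> S \<inter> Z K t = {})"
    proof
      assume "\<forall>\<^sub>F t in \<U>. W \<inter> S \<inter> Z K t = {}"
      then have "\<forall>\<^sub>F t in \<U>. measure \<mu> (W \<inter> S \<inter> Z K t) = 0"
        by (rule eventually_mono) simp
      then have "((\<lambda>t. measure \<mu> (W \<inter> S \<inter> Z K t)) \<longlongrightarrow> 0) \<U>" by (rule tendsto_eventually)
      then show False using S(3) \<W>(2)[OF W] by blast
    qed
    then have "\<forall>\<^sub>F t in \<U>. W \<inter> S \<inter> Z K t \<noteq> {}" using \<U>(3) by blast
    then show "\<forall>\<^sub>F t in \<U>. \<exists>x\<in>W \<inter> S. 3 / 4 * e < f' (t x)"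
      using ev_T by eventually_elim (use Z in \<open>auto simp: f'_def\<close>)
  qed
  then have "\<forall>\<^sub>F t in \<U>. \<forall>W\<in>\<W>. (\<exists>x\<in>W \<inter> S. f' (t x) < e / 2) \<and> (\<exists>x\<in>W \<inter> S. 3 / 4 * e < f' (t x))"
    using \<W>(1) by (simp add: eventually_ball_finite)
  then have "\<forall>\<^sub>F t in \<U>. False"
    using ev_T
  proof eventually_elim
    case (elim t)
    then show ?case using \<W>(3)[of t] by (meson not_less)
  qed
  then show False using \<U>(2) by (simp add: trivial_limit_def)
qed

text \<open>Elements of the closure near \<open>q\<close> are themselves limits in measure of maps in \<open>T\<close> near \<open>q\<close>.\<close>
lemma limit_in_measure_closure:
  fixes f :: "'x::{t2_space, uniform_space} \<Rightarrow> real"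
  assumes compact: "compact (UNIV :: 'x set)" and reg: "regular_borel_prob \<mu>"
    and f: "continuous_on UNIV f"
    and T: "\<And>t. t \<in> T \<Longrightarrow> continuous_on UNIV t" and frag: "\<And>p. p \<in> closure T \<Longrightarrow> fragmented p"
    and q: "q \<in> closure T" and "0 < e"
  shows "\<forall>\<^sub>F p in inf (nhds q) (principal (closure T)). ky_fan_close \<mu> f e p q"
proof -
  have lim: "\<forall>\<^sub>F t in inf (nhds p) (principal T). ky_fan_close \<mu> f (e / 2) t p" if "p \<in> closure T" for p
    by (rule limit_in_measure[OF compact reg f T frag that]) (use \<open>0 < e\<close> in simp_all)
  have "\<forall>\<^sub>F t in nhds q. t \<in> T \<longrightarrow> ky_fan_close \<mu> f (e / 2) t q"
    using lim[OF q] by (simp add: eventually_inf_principal)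
  then obtain W where W: "open W" "q \<in> W" "\<And>t. t \<in> W \<Longrightarrow> t \<in> T \<Longrightarrow> ky_fan_close \<mu> f (e / 2) t q"
    by (auto simp: eventually_nhds)
  have "ky_fan_close \<mu> f e p q" if "p \<in> W" "p \<in> closure T" for p
  proof -
    have "\<forall>\<^sub>F t in inf (nhds p) (principal T). ky_fan_close \<mu> f (e / 2) t p"
      using lim that by simp
    moreover have "\<forall>\<^sub>F t in inf (nhds p) (principal T). ky_fan_close \<mu> f (e / 2) t q"
      using W that by (auto simp: eventually_inf_principal eventually_nhds)
    ultimately have "\<forall>\<^sub>F t in inf (nhds p) (principal T). ky_fan_close \<mu> f (e / 2 + e / 2) p q"
      by eventually_elim (rule ky_fan_close_trans[OF reg ky_fan_close_sym])
    then show ?thesis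
      using nhds_closure_neq_bot[OF that(2)] by (simp add: eventually_const)
  qed
  then show ?thesis
    using W(1,2) unfolding eventually_inf_principal eventually_nhds by blast
qed

section \<open>Limits of measure-preserving maps\<close>

lemma eventually_nhds_continuous:
  assumes "continuous_on UNIV h" "eventually P (nhds (h a))"
  shows "\<forall>\<^sub>F x in nhds a. P (h x)"
proof -
  obtain W where W: "open W" "h a \<in> W" "\<forall>y\<in>W. P y"
    using assms(2) by (auto simp: eventually_nhds)
  then have "open (h -` W)" using assms(1) open_vimage by blast
  then show ?thesis using W unfolding eventually_nhds by (intro exI[of _ "h -` W"]) auto
qed

lemma comp_in_closure:
  assumes "continuous_on UNIV s" "\<And>t. t \<in> T \<Longrightarrow> s \<circ> t \<in> T'" "p \<in> closure T"
  shows "s \<circ> p \<in> closure T'"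
proof -
  have "(\<lambda>p. s \<circ> p) ` closure T \<subseteq> closure T'"
    using assms(2) closure_subset
    by (intro image_closure_subset continuous_on_subset[OF continuous_on_comp_left[OF assms(1)]]) auto
  then show ?thesis using assms(3) by blast
qed

text \<open>The homeomorphisms of a tame flow with an invariant measure, with the group itself forgotten.\<close>
locale tame_measure_group =
  fixes T :: "('x::{t2_space, uniform_space} \<Rightarrow> 'x) set" and \<mu> :: "'x measure"
  assumes compact_space: "compact (UNIV :: 'x set)"
    and regular: "regular_borel_prob \<mu>"
    and continuous: "t \<in> T \<Longrightarrow> continuous_on UNIV t"
    and comp_closed: "s \<in> T \<Longrightarrow> t \<in> T \<Longrightarrow> s \<circ> t \<in> T"
    and right_inverse: "t \<in> T \<Longrightarrow> \<exists>s\<in>T. t \<circ> s = id"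
    and invariant: "t \<in> T \<Longrightarrow> distr \<mu> borel t = \<mu>"
    and fragmented_limits: "p \<in> closure T \<Longrightarrow> fragmented p"
begin

lemma measure_vimage:
  assumes "t \<in> T" "B \<in> sets borel"
  shows "measure \<mu> (t -` B) = measure \<mu> B"
proof -
  have "t \<in> measurable \<mu> borel"
    using borel_measurable_continuous_onI[OF continuous[OF assms(1)]] regular_borel_probD(2)[OF regular]
    by (metis measurable_cong_sets)
  then have "measure (distr \<mu> borel t) B = measure \<mu> (t -` B)"
    using assms(2) regular_borel_probD(3)[OF regular] by (simp add: measure_distr)
  then show ?thesis using invariant[OF assms(1)] by simp
qed

lemma vimage_borel:
  assumes "t \<in> T" "B \<in> sets borel"
  shows "t -` B \<in> sets borel"
  using borel_measurable_continuous_onI[OF continuous[OF assms(1)]] assms(2)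
  by (metis measurable_sets_borel)

lemma ky_fan_close_comp_right:
  assumes "t \<in> T" "ky_fan_close \<mu> f e p q"
  shows "ky_fan_close \<mu> f e (p \<circ> t) (q \<circ> t)"
proof -
  obtain B where B: "B \<in> sets borel" "measure \<mu> B \<le> e" "\<forall>x. x \<notin> B \<longrightarrow> \<bar>f (p x) - f (q x)\<bar> \<le> e"
    using assms(2) by (auto simp: ky_fan_close_def)
  then show ?thesis
    unfolding ky_fan_close_def using assms(1) vimage_borel measure_vimage
    by (intro bexI[of _ "t -` B"]) auto
qed

lemma ky_fan_close_comp_right_cancel:
  assumes "t \<in> T" "ky_fan_close \<mu> f e (p \<circ> t) (q \<circ> t)"
  shows "ky_fan_close \<mu> f e p q"
proof -
  obtain s where "s \<in> T" "t \<circ> s = id" using right_inverse[OF assms(1)] by blast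
  then show ?thesis using ky_fan_close_comp_right[OF _ assms(2), of s] by (simp add: comp_assoc)
qed

text \<open>With \<open>d\<close> the distance in measure between \<open>f \<circ> p\<close> and \<open>f \<circ> q\<close>, which is continuous in
  \<open>p\<close> and \<open>q\<close> on the closure of \<open>T\<close>, invariance gives \<open>d (g \<circ> h, h) = d (g, id)\<close> for \<open>g, h\<close> in
  \<open>T\<close>. Letting first \<open>h\<close> tend to \<open>q\<close> and then \<open>g\<close> tend to \<open>v\<close> yields
  \<open>d (v, id) = d (v \<circ> q, q) = 0\<close>.

  The order of the limits matters: \<open>g\<close> is fixed and continuous when \<open>h\<close> varies, while right
  multiplication by \<open>q\<close> is continuous without any assumption.\<close>
lemma left_identity_AE_eq:
  fixes f :: "'x \<Rightarrow> real"
  assumes f: "continuous_on UNIV f"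
    and v: "v \<in> closure T" and q: "q \<in> closure T" and "v \<circ> q = q"
  shows "AE x in \<mu>. f (v x) = f x"
proof -
  have "ky_fan_close \<mu> f e v id" if "0 < e" for e
  proof -
    define d where "d = e / 4"
    have lim: "\<forall>\<^sub>F p' in nhds p. p' \<in> closure T \<longrightarrow> ky_fan_close \<mu> f d p' p" if "p \<in> closure T" for p
    proof -
      have "\<forall>\<^sub>F p' in inf (nhds p) (principal (closure T)). ky_fan_close \<mu> f d p' p"
        by (rule limit_in_measure_closure[OF compact_space regular f continuous fragmented_limits that])
          (use \<open>0 < e\<close> in \<open>simp_all add: d_def\<close>)
      then show ?thesis by (simp add: eventually_inf_principal)
    qed
    have T_closure: "t \<in> closure T" if "t \<in> T" for t using that closure_subset by blast
    have comp_T: "t \<circ> p \<in> closure T" if "t \<in> T" "p \<in> closure T" for t p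
      using comp_in_closure[OF continuous[OF that(1)] comp_closed[OF that(1)] that(2)] .
    \<comment> \<open>Choose \<open>g\<close> near \<open>v\<close> first, so that \<open>g \<circ> q\<close> is near \<open>v \<circ> q = q\<close>.\<close>
    have near_v: "\<forall>\<^sub>F p in nhds v. p \<in> closure T \<longrightarrow> ky_fan_close \<mu> f d p v" by (rule lim[OF v])
    have near_vq: "\<forall>\<^sub>F p in nhds v. p \<circ> q \<in> closure T \<longrightarrow> ky_fan_close \<mu> f d (p \<circ> q) (v \<circ> q)"
      by (rule eventually_nhds_continuous[OF continuous_on_comp_right])
        (use lim[OF q] \<open>v \<circ> q = q\<close> in simp)
    have "\<forall>\<^sub>F p in inf (nhds v) (principal T). p \<in> T \<and> ky_fan_close \<mu> f d p v \<and> ky_fan_close \<mu> f d (p \<circ> q) q"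
      unfolding eventually_inf_principal using near_v near_vq
      by eventually_elim (use T_closure comp_T[OF _ q] \<open>v \<circ> q = q\<close> in simp)
    then obtain g where g: "g \<in> T" "ky_fan_close \<mu> f d g v" "ky_fan_close \<mu> f d (g \<circ> q) q"
      using eventually_happens' nhds_closure_neq_bot[OF v] by blast
    \<comment> \<open>Then choose \<open>h\<close> near \<open>q\<close>, depending on \<open>g\<close>, so that \<open>g \<circ> h\<close> is near \<open>g \<circ> q\<close>.\<close>
    have near_q: "\<forall>\<^sub>F p in nhds q. p \<in> closure T \<longrightarrow> ky_fan_close \<mu> f d p q" by (rule lim[OF q])
    have near_gq: "\<forall>\<^sub>F p in nhds q. g \<circ> p \<in> closure T \<longrightarrow> ky_fan_close \<mu> f d (g \<circ> p) (g \<circ> q)"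
      by (rule eventually_nhds_continuous[where P = "\<lambda>p. p \<in> closure T \<longrightarrow> ky_fan_close \<mu> f d p (g \<circ> q)",
            OF continuous_on_comp_left[OF continuous[OF g(1)]]])
        (use lim[OF comp_T[OF g(1) q]] in simp)
    have "\<forall>\<^sub>F p in inf (nhds q) (principal T). p \<in> T \<and> ky_fan_close \<mu> f d p q \<and> ky_fan_close \<mu> f d (g \<circ> p) (g \<circ> q)"
      unfolding eventually_inf_principal using near_q near_gq
      by eventually_elim (use T_closure comp_T[OF g(1)] in simp)
    then obtain h where h: "h \<in> T" "ky_fan_close \<mu> f d h q" "ky_fan_close \<mu> f d (g \<circ> h) (g \<circ> q)"
      using eventually_happens' nhds_closure_neq_bot[OF q] by blast
    have "ky_fan_close \<mu> f (d + d + d) (g \<circ> h) h"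
      using ky_fan_close_trans[OF regular ky_fan_close_trans[OF regular h(3) g(3)] ky_fan_close_sym[OF h(2)]] .
    then have "ky_fan_close \<mu> f (d + d + d) g id"
      using ky_fan_close_comp_right_cancel[OF h(1), of f "d + d + d" g id] by simp
    then have "ky_fan_close \<mu> f (d + (d + d + d)) v id"
      by (rule ky_fan_close_trans[OF regular ky_fan_close_sym[OF g(2)]])
    then show ?thesis by (simp add: d_def)
  qed
  then show ?thesis using ky_fan_close_all_imp_AE_eq[OF regular, of f v id] by simp
qed

end

section \<open>Minimal left ideals\<close>

text \<open>Let \<open>N\<close> be a minimal left ideal of the closure of \<open>T\<close>, obtained as a minimal closed nonempty subset
  invariant under composition with \<open>T\<close> on the left. For \<open>q \<in> N\<close> the set of all \<open>v \<circ> q\<close> with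
  \<open>v \<in> N\<close> is a left ideal inside \<open>N\<close>, hence all of \<open>N\<close>, and contains \<open>q\<close>. The last property says that
  the orbit closure of \<open>v x\<close> is minimal: it is contained in the image of \<open>N\<close> under evaluation at
  \<open>x\<close>, and each \<open>r \<in> N\<close> generates \<open>N\<close>.\<close>
lemma exists_minimal_limit:
  fixes T :: "('x::t2_space \<Rightarrow> 'x) set"
  assumes compact: "compact (UNIV :: 'x set)"
    and cont: "\<And>t. t \<in> T \<Longrightarrow> continuous_on UNIV t"
    and id: "id \<in> T" and comp: "\<And>s t. s \<in> T \<Longrightarrow> t \<in> T \<Longrightarrow> s \<circ> t \<in> T"
  obtains v q where "v \<in> closure T" "q \<in> closure T" "v \<circ> q = q"
    "\<And>x z. z \<in> closure ((\<lambda>t. t (v x)) ` T) \<Longrightarrow> v x \<in> closure ((\<lambda>t. t z) ` T)"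
proof -
  have compact_closed: "compact N" if "closed N" for N :: "('x \<Rightarrow> 'x) set"
    using compact_Int_closed[OF compact_fun_space[OF compact] that] by simp
  define P where "P N \<longleftrightarrow> N \<noteq> {} \<and> closed N \<and> N \<subseteq> closure T \<and> (\<forall>t\<in>T. \<forall>r\<in>N. t \<circ> r \<in> N)" for N
  obtain N where N: "P N" and N_min: "\<And>M. P M \<Longrightarrow> M \<subseteq> N \<Longrightarrow> M = N"
  proof (rule exists_minimal_set[of P "closure T"])
    have "s \<circ> p \<in> closure T" if "s \<in> T" "p \<in> closure T" for s p
      using comp_in_closure[OF cont[OF that(1)] comp[OF that(1)] that(2)] .
    then show "P (closure T)"
      unfolding P_def using id closure_subset by auto
  next
    fix \<C> assume \<C>: "\<C> \<noteq> {}" "\<And>N. N \<in> \<C> \<Longrightarrow> P N" "\<And>M N. M \<in> \<C> \<Longrightarrow> N \<in> \<C> \<Longrightarrow> M \<subseteq> N \<or> N \<subseteq> M"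
    have "UNIV \<inter> \<Inter>\<C> \<noteq> {}"
      by (rule chain_closed_Inter_meets[OF compact_fun_space[OF compact]])
        (use \<C> in \<open>auto simp: P_def\<close>)
    then show "P (\<Inter>\<C>)" using \<C>(1,2) unfolding P_def by blast
  qed auto
  have orbit: "closure ((\<lambda>t. t \<circ> r) ` T) = N" if r: "r \<in> N" for r
  proof (rule N_min)
    have sub: "(\<lambda>t. t \<circ> r) ` T \<subseteq> N" using N r by (auto simp: P_def)
    then show *: "closure ((\<lambda>t. t \<circ> r) ` T) \<subseteq> N" using N by (intro closure_minimal) (auto simp: P_def)
    have "s \<circ> p \<in> closure ((\<lambda>t. t \<circ> r) ` T)" if "s \<in> T" "p \<in> closure ((\<lambda>t. t \<circ> r) ` T)" for s p
      by (rule comp_in_closure[OF cont[OF that(1)] _ that(2)])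
        (use comp[OF that(1)] in \<open>auto simp: comp_assoc[symmetric]\<close>)
    then show "P (closure ((\<lambda>t. t \<circ> r) ` T))"
      using id * N unfolding P_def by auto
  qed
  obtain q where q: "q \<in> N" using N by (auto simp: P_def)
  have "(\<lambda>v. v \<circ> q) ` N = N"
  proof (rule N_min)
    have "(\<lambda>v. v \<circ> q) ` closure T \<subseteq> closure ((\<lambda>t. t \<circ> q) ` T)"
      using closure_subset[of "(\<lambda>t. t \<circ> q) ` T"]
      by (intro image_closure_subset continuous_on_subset[OF continuous_on_comp_right]) auto
    then show *: "(\<lambda>v. v \<circ> q) ` N \<subseteq> N" using orbit[OF q] N by (auto simp: P_def)
    have "compact ((\<lambda>v. v \<circ> q) ` N)"
      using N compact_closed
      by (intro compact_continuous_image continuous_on_subset[OF continuous_on_comp_right])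
        (auto simp: P_def)
    then have "closed ((\<lambda>v. v \<circ> q) ` N)" by (rule compact_fun_imp_closed)
    moreover have "t \<circ> (v \<circ> q) \<in> (\<lambda>v. v \<circ> q) ` N" if "t \<in> T" "v \<in> N" for t v
      using N that unfolding P_def by (auto simp: comp_assoc[symmetric])
    ultimately show "P ((\<lambda>v. v \<circ> q) ` N)" using * N unfolding P_def by blast
  qed
  then obtain v where v: "v \<in> N" "v \<circ> q = q" using q by (metis imageE)
  show ?thesis
  proof
    show "v \<in> closure T" "q \<in> closure T" "v \<circ> q = q" using v q N by (auto simp: P_def)
  next
    fix x z assume z: "z \<in> closure ((\<lambda>t. t (v x)) ` T)"
    have "compact ((\<lambda>r. r x) ` N)"
      using N compact_closed
      by (intro compact_continuous_image continuous_on_subset[OF continuous_on_product_coordinates])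
        (auto simp: P_def)
    then have "closed ((\<lambda>r. r x) ` N)" by (rule compact_imp_closed)
    moreover have "(\<lambda>t. t (v x)) ` T \<subseteq> (\<lambda>r. r x) ` N"
    proof
      fix y assume "y \<in> (\<lambda>t. t (v x)) ` T"
      then obtain t where "t \<in> T" "y = (t \<circ> v) x" by auto
      then show "y \<in> (\<lambda>r. r x) ` N" using N v(1) unfolding P_def by blast
    qed
    ultimately have "z \<in> (\<lambda>r. r x) ` N" using z closure_minimal by blast
    then obtain r where r: "r \<in> N" "z = r x" by blast
    have "(\<lambda>p. p x) ` closure ((\<lambda>t. t \<circ> r) ` T) \<subseteq> closure ((\<lambda>t. t z) ` T)"
      using r(2) closure_subset[of "(\<lambda>t. t z) ` T"]
      by (intro image_closure_subset continuous_on_subset[OF continuous_on_product_coordinates]) auto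
    then show "v x \<in> closure ((\<lambda>t. t z) ` T)" using orbit[OF r(1)] v(1) by blast
  qed
qed

section \<open>Ergodic measures\<close>

text \<open>Outer regularity follows from inner regularity of complements, because compact sets are closed.\<close>
lemma regular_borel_probI:
  fixes \<nu> :: "'x::t2_space measure"
  assumes "prob_space \<nu>" and sets[simp]: "sets \<nu> = sets borel"
    and inner: "\<And>B e. B \<in> sets borel \<Longrightarrow> 0 < e \<Longrightarrow> \<exists>K\<subseteq>B. compact K \<and> measure \<nu> (B - K) < e"
  shows "regular_borel_prob \<nu>"
  unfolding regular_borel_prob_def
proof (intro conjI ballI)
  interpret prob_space \<nu> by fact
  have space: "space \<nu> = UNIV" using sets_eq_imp_space_eq[OF sets] by simp
  fix B :: "'x set" assume B: "B \<in> sets borel"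
  show "emeasure \<nu> B = (SUP K\<in>{K. K \<subseteq> B \<and> compact K}. emeasure \<nu> K)"
  proof (rule antisym)
    show "emeasure \<nu> B \<le> (SUP K\<in>{K. K \<subseteq> B \<and> compact K}. emeasure \<nu> K)"
    proof (rule ennreal_le_epsilon)
      fix e :: real assume "0 < e"
      then obtain K where K: "K \<subseteq> B" "compact K" "measure \<nu> (B - K) < e"
        using inner[OF B] by blast
      have [simp]: "K \<in> sets borel" using K(2) by (simp add: borel_closed compact_imp_closed)
      have "emeasure \<nu> B = emeasure \<nu> (K \<union> (B - K))" using K(1) by (simp add: Un_absorb1)
      also have "\<dots> \<le> emeasure \<nu> K + emeasure \<nu> (B - K)"
        using B by (intro emeasure_subadditive) auto
      also have "\<dots> \<le> (SUP K\<in>{K. K \<subseteq> B \<and> compact K}. emeasure \<nu> K) + ennreal e"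
        using K by (intro add_mono SUP_upper) (auto simp: emeasure_eq_measure intro: ennreal_leI)
      finally show "emeasure \<nu> B \<le> (SUP K\<in>{K. K \<subseteq> B \<and> compact K}. emeasure \<nu> K) + ennreal e" .
    qed
    show "(SUP K\<in>{K. K \<subseteq> B \<and> compact K}. emeasure \<nu> K) \<le> emeasure \<nu> B"
      using B by (intro SUP_least emeasure_mono) auto
  qed
  show "emeasure \<nu> B = (INF U\<in>{U. B \<subseteq> U \<and> open U}. emeasure \<nu> U)"
  proof (rule antisym)
    show "(INF U\<in>{U. B \<subseteq> U \<and> open U}. emeasure \<nu> U) \<le> emeasure \<nu> B"
    proof (rule ennreal_le_epsilon)
      fix e :: real assume "0 < e"
      moreover have "UNIV - B \<in> sets borel" using B by auto
      ultimately obtain K where K: "K \<subseteq> UNIV - B" "compact K" "measure \<nu> (UNIV - B - K) < e"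
        using inner by blast
      have U: "B \<subseteq> UNIV - K" "open (UNIV - K)"
        using K compact_imp_closed[OF K(2)] by (auto simp: open_Diff)
      then have "(INF U\<in>{U. B \<subseteq> U \<and> open U}. emeasure \<nu> U) \<le> emeasure \<nu> (UNIV - K)"
        by (intro INF_lower) auto
      also have "UNIV - K = B \<union> (UNIV - B - K)" using K(1) by auto
      also have "emeasure \<nu> \<dots> \<le> emeasure \<nu> B + emeasure \<nu> (UNIV - B - K)"
        using B K(2) by (intro emeasure_subadditive) (auto simp: borel_closed compact_imp_closed)
      also have "\<dots> \<le> emeasure \<nu> B + ennreal e"
        using K by (intro add_mono) (auto simp: emeasure_eq_measure intro: ennreal_leI)
      finally show "(INF U\<in>{U. B \<subseteq> U \<and> open U}. emeasure \<nu> U) \<le> emeasure \<nu> B + ennreal e" .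
    qed
    show "emeasure \<nu> B \<le> (INF U\<in>{U. B \<subseteq> U \<and> open U}. emeasure \<nu> U)"
      by (intro INF_greatest emeasure_mono) (auto simp: borel_open)
  qed
qed (use assms in auto)

lemma flow_continuous:
  assumes "flow G \<phi>" "g \<in> carrier G"
  shows "continuous_on UNIV (\<phi> g)"
  using flow.homeomorphism_action[OF assms] by (simp add: homeomorphism_def)

lemma flow_measurable:
  assumes "flow G \<phi>" "g \<in> carrier G" "sets \<mu> = sets borel"
  shows "\<phi> g \<in> measurable \<mu> borel"
  using borel_measurable_continuous_onI[OF flow_continuous[OF assms(1,2)]] assms(3)
  by (metis measurable_cong_sets)

lemma Prob_inv_vimage:
  assumes "flow G \<phi>" "\<mu> \<in> Prob_inv G \<phi>" "g \<in> carrier G" "B \<in> sets borel"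
  shows "emeasure \<mu> (\<phi> g -` B) = emeasure \<mu> B"
proof -
  have reg: "regular_borel_prob \<mu>" and inv: "distr \<mu> borel (\<phi> g) = \<mu>"
    using assms by (auto simp: Prob_inv_def)
  have "emeasure (distr \<mu> borel (\<phi> g)) B = emeasure \<mu> (\<phi> g -` B)"
    using flow_measurable[OF assms(1,3) regular_borel_probD(2)[OF reg]] assms(4)
    by (simp add: emeasure_distr regular_borel_probD(3)[OF reg])
  then show ?thesis using inv by simp
qed

lemma Prob_inv_uniform_measure:
  fixes \<phi> :: "'g \<Rightarrow> 'x::{t2_space, uniform_space} \<Rightarrow> 'x"
  assumes flow: "flow G \<phi>" and \<mu>: "\<mu> \<in> Prob_inv G \<phi>" and A: "A \<in> sets borel"
    and inv: "\<And>g. g \<in> carrier G \<Longrightarrow> \<phi> g -` A = A" and pos: "0 < measure \<mu> A"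
  shows "uniform_measure \<mu> A \<in> Prob_inv G \<phi>"
proof -
  have reg: "regular_borel_prob \<mu>" using \<mu> by (simp add: Prob_inv_def)
  interpret prob_space \<mu> using reg regular_borel_probD by blast
  note [simp] = regular_borel_probD(2)[OF reg]
  have A': "emeasure \<mu> A \<noteq> 0" "emeasure \<mu> A \<noteq> \<infinity>"
    using pos by (simp_all add: emeasure_eq_measure)
  have "regular_borel_prob (uniform_measure \<mu> A)"
  proof (rule regular_borel_probI)
    show "prob_space (uniform_measure \<mu> A)" using A' by (rule prob_space_uniform_measure)
    show "sets (uniform_measure \<mu> A) = sets borel" by simp
    fix B :: "'x set" and e :: real assume B: "B \<in> sets borel" and "0 < e"
    obtain K where K: "K \<subseteq> B" "compact K" "measure \<mu> (B - K) < e * measure \<mu> A"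
      using regular_inner_approx[OF reg B, of "e * measure \<mu> A"] \<open>0 < e\<close> pos by auto
    then have BK: "B - K \<in> sets borel" using B by (auto simp: borel_closed compact_imp_closed)
    then have "measure (uniform_measure \<mu> A) (B - K) = measure \<mu> (A \<inter> (B - K)) / measure \<mu> A"
      using A' by simp
    also have "\<dots> \<le> measure \<mu> (B - K) / measure \<mu> A"
      using BK A by (intro divide_right_mono finite_measure_mono) auto
    also have "\<dots> < e" using K(3) pos by (simp add: divide_less_eq)
    finally show "\<exists>K\<subseteq>B. compact K \<and> measure (uniform_measure \<mu> A) (B - K) < e" using K by blast
  qed
  moreover have "distr (uniform_measure \<mu> A) borel (\<phi> g) = uniform_measure \<mu> A" if g: "g \<in> carrier G" for g
  proof (rule measure_eqI)
    fix B assume "B \<in> sets (distr (uniform_measure \<mu> A) borel (\<phi> g))"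
    then have B: "B \<in> sets borel" by simp
    have meas: "\<phi> g \<in> measurable (uniform_measure \<mu> A) borel" "\<phi> g \<in> measurable \<mu> borel"
      using flow_measurable[OF flow g] by simp_all
    then have "\<phi> g -` B \<in> sets borel"
      using measurable_sets[OF meas(2) B] regular_borel_probD(3)[OF reg] by simp
    then have "emeasure (distr (uniform_measure \<mu> A) borel (\<phi> g)) B = emeasure \<mu> (A \<inter> \<phi> g -` B) / emeasure \<mu> A"
      using meas(1) A B regular_borel_probD(3)[OF reg] by (simp add: emeasure_distr)
    also have "A \<inter> \<phi> g -` B = \<phi> g -` (A \<inter> B)" using inv[OF g] by auto
    also have "emeasure \<mu> \<dots> = emeasure \<mu> (A \<inter> B)"
      by (rule Prob_inv_vimage[OF flow \<mu> g sets.Int[OF A B]])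
    finally show "emeasure (distr (uniform_measure \<mu> A) borel (\<phi> g)) B = emeasure (uniform_measure \<mu> A) B"
      using A B by simp
  qed simp
  ultimately show ?thesis by (simp add: Prob_inv_def)
qed

text \<open>Otherwise \<open>\<mu>\<close> would be a proper convex combination of its normalised restrictions to \<open>A\<close> and to
  the complement of \<open>A\<close>, which are again invariant and regular.\<close>
lemma Erg_invariant_set:
  fixes \<phi> :: "'g \<Rightarrow> 'x::{t2_space, uniform_space} \<Rightarrow> 'x"
  assumes flow: "flow G \<phi>" and erg: "\<mu> \<in> Erg G \<phi>" and A: "A \<in> sets borel"
    and inv: "\<And>g. g \<in> carrier G \<Longrightarrow> \<phi> g -` A = A" and pos: "0 < measure \<mu> A"
  shows "measure \<mu> A = 1"
proof (rule ccontr)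
  assume "measure \<mu> A \<noteq> 1"
  have \<mu>: "\<mu> \<in> Prob_inv G \<phi>" using erg by (simp add: Erg_def)
  then have reg: "regular_borel_prob \<mu>" by (simp add: Prob_inv_def)
  interpret prob_space \<mu> using reg regular_borel_probD by blast
  note [simp] = regular_borel_probD(2)[OF reg]
  define A' where "A' = UNIV - A"
  have A': "A' \<in> sets borel" using A by (auto simp: A'_def)
  have compl: "measure \<mu> A' = 1 - measure \<mu> A"
    using prob_compl[of A] A regular_borel_probD(3)[OF reg] by (simp add: A'_def)
  then have pos': "0 < measure \<mu> A'" "measure \<mu> A' < 1"
    using \<open>measure \<mu> A \<noteq> 1\<close> pos prob_le_1[of A] by linarith+
  have "\<phi> g -` A' = A'" if "g \<in> carrier G" for g
    using inv[OF that] by (auto simp: A'_def)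
  then have "uniform_measure \<mu> A \<in> Prob_inv G \<phi>" "uniform_measure \<mu> A' \<in> Prob_inv G \<phi>"
    using Prob_inv_uniform_measure[OF flow \<mu>] A A' inv pos pos'(1) by blast+
  moreover have nn: "emeasure \<mu> A \<noteq> 0" "emeasure \<mu> A \<noteq> \<infinity>" "emeasure \<mu> A' \<noteq> 0" "emeasure \<mu> A' \<noteq> \<infinity>"
    using pos pos' by (simp_all add: emeasure_eq_measure)
  have "measure \<mu> B = (1 - measure \<mu> A') * measure (uniform_measure \<mu> A) B
      + measure \<mu> A' * measure (uniform_measure \<mu> A') B" if B: "B \<in> sets borel" for B
  proof -
    have "B = (A \<inter> B) \<union> (A' \<inter> B)" by (auto simp: A'_def)
    then have "measure \<mu> B = measure \<mu> (A \<inter> B) + measure \<mu> (A' \<inter> B)"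
      using A A' B finite_measure_Union[of "A \<inter> B" "A' \<inter> B"] by (auto simp: A'_def)
    then show ?thesis using nn B compl pos pos' by simp
  qed
  ultimately have eq: "uniform_measure \<mu> A = uniform_measure \<mu> A'"
    using erg pos' unfolding Erg_def by blast
  have "measure (uniform_measure \<mu> A) A = 1" using nn A pos by simp
  moreover have "measure (uniform_measure \<mu> A') A = 0" using nn A by (simp add: A'_def Diff_Int_distrib2)
  ultimately show False using eq by simp
qed

lemma flow_comp:
  assumes "flow G \<phi>" "g \<in> carrier G" "h \<in> carrier G"
  shows "\<phi> (g \<otimes>\<^bsub>G\<^esub> h) = \<phi> g \<circ> \<phi> h"
proof -
  interpret flow G \<phi> by fact
  show ?thesis using composition_rule assms by auto
qed

lemma flow_one:
  assumes "flow G \<phi>"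
  shows "\<phi> \<one>\<^bsub>G\<^esub> = id"
proof -
  interpret flow G \<phi> by fact
  show ?thesis using id_eq_one by (auto simp: fun_eq_iff restrict_def)
qed

lemma flow_group:
  assumes "flow G \<phi>"
  shows "group G"
proof -
  interpret flow G \<phi> by fact
  show ?thesis using group_hom group_hom.axioms(1) by auto
qed

text \<open>The union of all translates of \<open>W\<close> is invariant and thus has full measure. It is an uncountable union in
  general, but inner regularity approximates it by compact sets, each of which is covered by
  finitely many translates.\<close>
lemma Erg_countably_many_translates_cover:
  fixes \<phi> :: "'g \<Rightarrow> 'x::{t2_space, uniform_space} \<Rightarrow> 'x"
  assumes flow: "flow G \<phi>" and erg: "\<mu> \<in> Erg G \<phi>" and W: "open W" "0 < emeasure \<mu> W"
  shows "\<exists>C\<subseteq>\<phi> ` carrier G. countable C \<and> measure \<mu> (\<Union>t\<in>C. t -` W) = 1"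
proof -
  interpret group G using flow by (rule flow_group)
  have \<mu>: "\<mu> \<in> Prob_inv G \<phi>" using erg by (simp add: Erg_def)
  then have reg: "regular_borel_prob \<mu>" by (simp add: Prob_inv_def)
  interpret prob_space \<mu> using reg regular_borel_probD by blast
  note [simp] = regular_borel_probD(2)[OF reg]
  define O' where "O' = (\<Union>t\<in>\<phi> ` carrier G. t -` W)"
  have open_t: "open (t -` W)" if "t \<in> \<phi> ` carrier G" for t
    using that W(1) flow_continuous[OF flow] open_vimage by blast
  then have "open O'" by (auto simp: O'_def)
  then have O': "O' \<in> sets borel" by (rule borel_open)
  have "\<phi> h -` O' = O'" if h: "h \<in> carrier G" for h
  proof
    show "\<phi> h -` O' \<subseteq> O'"
    proof
      fix x assume "x \<in> \<phi> h -` O'"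
      then obtain g where g: "g \<in> carrier G" "\<phi> g (\<phi> h x) \<in> W" by (auto simp: O'_def)
      then show "x \<in> O'"
        using flow_comp[OF flow g(1) h] h by (auto simp: O'_def intro!: bexI[of _ "g \<otimes>\<^bsub>G\<^esub> h"])
    qed
    show "O' \<subseteq> \<phi> h -` O'"
    proof
      fix x assume "x \<in> O'"
      then obtain g where g: "g \<in> carrier G" "\<phi> g x \<in> W" by (auto simp: O'_def)
      have "\<phi> g = \<phi> (g \<otimes>\<^bsub>G\<^esub> inv\<^bsub>G\<^esub> h) \<circ> \<phi> h"
        using flow_comp[OF flow, of "g \<otimes>\<^bsub>G\<^esub> inv\<^bsub>G\<^esub> h" h] g(1) h by (simp add: m_assoc)
      then show "x \<in> \<phi> h -` O'"
        using g h by (auto simp: O'_def intro!: bexI[of _ "g \<otimes>\<^bsub>G\<^esub> inv\<^bsub>G\<^esub> h"])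
    qed
  qed
  moreover have "W \<subseteq> O'"
    using flow_one[OF flow] by (auto simp: O'_def intro!: bexI[of _ "\<one>\<^bsub>G\<^esub>"])
  then have "emeasure \<mu> W \<le> emeasure \<mu> O'" using O' by (intro emeasure_mono) auto
  then have "0 < measure \<mu> O'" using W(2) by (simp add: emeasure_eq_measure)
  ultimately have one: "measure \<mu> O' = 1" using Erg_invariant_set[OF flow erg O'] by blast
  have "\<exists>D. finite D \<and> D \<subseteq> \<phi> ` carrier G \<and> 1 - inverse (real (Suc n)) < measure \<mu> (\<Union>t\<in>D. t -` W)" for n
  proof -
    obtain K where K: "K \<subseteq> O'" "compact K" "measure \<mu> (O' - K) < inverse (real (Suc n))"
      using regular_inner_approx[OF reg O', of "inverse (real (Suc n))"] by auto
    obtain D where D: "D \<subseteq> \<phi> ` carrier G" "finite D" "K \<subseteq> (\<Union>t\<in>D. t -` W)"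
      using compactE_image[OF K(2), of "\<phi> ` carrier G" "\<lambda>t. t -` W"] open_t K(1)
      unfolding O'_def by metis
    have K_meas: "K \<in> sets borel" using K(2) by (simp add: borel_closed compact_imp_closed)
    have "measure \<mu> (O' - K) = measure \<mu> O' - measure \<mu> K"
      using K O' K_meas by (intro finite_measure_Diff) auto
    moreover have "measure \<mu> K \<le> measure \<mu> (\<Union>t\<in>D. t -` W)"
      using D open_t by (intro finite_measure_mono) (auto intro!: borel_open open_UN)
    ultimately show ?thesis using K(3) one D(1,2) by (intro exI[of _ D]) auto
  qed
  then obtain D where D: "\<And>n. finite (D n)" "\<And>n. D n \<subseteq> \<phi> ` carrier G"
    "\<And>n. 1 - inverse (real (Suc n)) < measure \<mu> (\<Union>t\<in>D n. t -` W)" by metis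
  define C where "C = (\<Union>n. D n)"
  have "countable C" "C \<subseteq> \<phi> ` carrier G" using D(1,2) by (auto simp: C_def countable_finite)
  have C_meas: "(\<Union>t\<in>C. t -` W) \<in> sets borel"
    using open_t \<open>C \<subseteq> \<phi> ` carrier G\<close> by (intro borel_open open_UN) auto
  have "1 - inverse (real (Suc n)) < measure \<mu> (\<Union>t\<in>C. t -` W)" for n
  proof -
    have "measure \<mu> (\<Union>t\<in>D n. t -` W) \<le> measure \<mu> (\<Union>t\<in>C. t -` W)"
      using C_meas by (intro finite_measure_mono) (auto simp: C_def)
    then show ?thesis using D(3)[of n] by simp
  qed
  then have "\<not> 0 < 1 - measure \<mu> (\<Union>t\<in>C. t -` W)"
    using reals_Archimedean by (metis diff_less_eq less_asym add.commute)
  then have "measure \<mu> (\<Union>t\<in>C. t -` W) = 1" using prob_le_1 by (metis antisym_conv2 diff_gt_0_iff_gt linorder_not_le nle_le)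
  then show ?thesis using \<open>countable C\<close> \<open>C \<subseteq> \<phi> ` carrier G\<close> by blast
qed

text \<open>The closure of a countable set under countably many finitary operations, each with countably many
  values. The operations \<open>D\<close> will collect the group elements that witness a recurrence statement
  about a finite set of group elements.\<close>
lemma countable_submonoid_closed_under:
  fixes D :: "('x \<Rightarrow> 'x) set \<Rightarrow> ('x \<Rightarrow> 'x) set"
  assumes T: "id \<in> T" "\<And>s t. s \<in> T \<Longrightarrow> t \<in> T \<Longrightarrow> s \<circ> t \<in> T"
    and D: "\<And>F. finite F \<Longrightarrow> F \<subseteq> T \<Longrightarrow> countable (D F) \<and> D F \<subseteq> T"
  obtains S where "S \<subseteq> T" "countable S" "id \<in> S" "\<And>s t. s \<in> S \<Longrightarrow> t \<in> S \<Longrightarrow> s \<circ> t \<in> S"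
    "\<And>F. finite F \<Longrightarrow> F \<subseteq> S \<Longrightarrow> D F \<subseteq> S"
proof -
  define step where "step A = A \<union> (\<lambda>(s, t). s \<circ> t) ` (A \<times> A) \<union> (\<Union>F\<in>{F. finite F \<and> F \<subseteq> A}. D F)" for A
  define H where "H n = (step ^^ n) {id}" for n
  have H_Suc: "H (Suc n) = step (H n)" for n by (simp add: H_def)
  have H: "countable (H n) \<and> H n \<subseteq> T" for n
  proof (induction n)
    case 0
    then show ?case using T by (simp add: H_def)
  next
    case (Suc n)
    have "countable {F. finite F \<and> F \<subseteq> H n}"
      using countable_Collect_finite_subset[of "H n"] Suc by (simp add: conj_commute)
    then have "countable (H (Suc n))"
      unfolding H_Suc step_def using Suc D by auto
    moreover have "s \<circ> t \<in> T" if "s \<in> H n" "t \<in> H n" for s t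
      using Suc that by (intro T(2)) auto
    moreover have "D F \<subseteq> T" if "finite F" "F \<subseteq> H n" for F
      using D[of F] Suc that by (metis subset_trans)
    ultimately show ?case
      using Suc unfolding H_Suc step_def by auto
  qed
  have H_mono: "H m \<subseteq> H n" if "m \<le> n" for m n
    using that by (rule lift_Suc_mono_le[rotated]) (auto simp: H_Suc step_def)
  define S where "S = (\<Union>n. H n)"
  have S_H: "\<exists>n. F \<subseteq> H n" if "finite F" "F \<subseteq> S" for F
    using that
  proof (induction F)
    case (insert a F)
    then obtain m n where "F \<subseteq> H m" "a \<in> H n" by (auto simp: S_def)
    then have "insert a F \<subseteq> H (max m n)"
      using H_mono[of m "max m n"] H_mono[of n "max m n"] by auto
    then show ?case by blast
  qed simp
  show ?thesis
  proof
    show "S \<subseteq> T" "countable S" using H by (auto simp: S_def)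
    have "id \<in> H 0" by (simp add: H_def)
    then show "id \<in> S" unfolding S_def by blast
  next
    fix s t assume "s \<in> S" "t \<in> S"
    then obtain n where "{s, t} \<subseteq> H n" using S_H[of "{s, t}"] by auto
    then have "s \<circ> t \<in> H (Suc n)" unfolding H_Suc step_def by force
    then show "s \<circ> t \<in> S" unfolding S_def by blast
  next
    fix F assume "finite F" "F \<subseteq> S"
    then obtain n where "F \<subseteq> H n" using S_H by blast
    then have "D F \<subseteq> H (Suc n)" unfolding H_Suc step_def using \<open>finite F\<close> by blast
    then show "D F \<subseteq> S" unfolding S_def by blast
  qed
qed

section \<open>Supports of ergodic measures of tame flows\<close>

lemma compact_Urysohn:
  fixes z :: "'x::t2_space"
  assumes "compact (UNIV :: 'x set)" "closed A" "z \<notin> A"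
  obtains f :: "'x \<Rightarrow> real" where "continuous_on UNIV f" "\<And>x. x \<in> A \<Longrightarrow> f x = 0" "f z = 1"
proof -
  have "normal_space (euclidean :: 'x topology)"
    using assms(1) Hausdorff_space_euclidean_t2
    by (intro compact_Hausdorff_or_regular_imp_normal_space) (auto simp: compact_space_def)
  then obtain f where "continuous_map euclidean (top_of_set {0..1::real}) f" "f ` A \<subseteq> {0}" "f ` {z} \<subseteq> {1}"
    by (rule Urysohn_lemma[of euclidean A "{z}" 0 1]) (use assms in \<open>auto simp: disjnt_def\<close>)
  then show ?thesis by (intro that[of f]) (auto simp: continuous_map_in_subtopology)
qed

lemma subflow_supp:
  assumes flow: "flow G \<phi>" and \<mu>: "\<mu> \<in> Prob_inv G \<phi>"
  shows "subflow G \<phi> (supp \<mu>)"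
  unfolding subflow_def
proof (intro conjI ballI)
  have reg: "regular_borel_prob \<mu>" using \<mu> by (simp add: Prob_inv_def)
  interpret prob_space \<mu> using reg regular_borel_probD by blast
  have "\<not> ((\<lambda>t. measure \<mu> (UNIV \<inter> UNIV)) \<longlongrightarrow> 0) sequentially"
    using regular_borel_probD(4)[OF reg] by (simp add: LIMSEQ_const_iff)
  then obtain S where "S \<noteq> {}"
    "\<And>W. open W \<Longrightarrow> W \<inter> S \<noteq> {} \<Longrightarrow> \<not> ((\<lambda>t. measure \<mu> (W \<inter> S \<inter> UNIV)) \<longlongrightarrow> 0) sequentially"
    using asymptotic_kernel[OF reg _ flow.compact_phase_space[OF flow], of "\<lambda>_. UNIV" sequentially]
    by (metis space_borel sets.top)
  then obtain x where x: "\<And>W. open W \<Longrightarrow> x \<in> W \<Longrightarrow> measure \<mu> (W \<inter> S) \<noteq> 0"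
    by (fastforce simp: LIMSEQ_const_iff)
  have "0 < emeasure \<mu> W" if W: "open W" "x \<in> W" for W
  proof (rule ccontr)
    assume "\<not> 0 < emeasure \<mu> W"
    then have "emeasure \<mu> W = 0" by simp
    moreover have "W \<in> sets \<mu>" using W(1) regular_borel_probD(2)[OF reg] by simp
    ultimately have "emeasure \<mu> (W \<inter> S) = 0" by (metis emeasure_mono inf_le1 le_zero_eq)
    then show False using x[OF W] by (simp add: measure_def)
  qed
  then have "x \<in> supp \<mu>" by (simp add: supp_def)
  then show "supp \<mu> \<noteq> {}" by blast
  have "- supp \<mu> = \<Union>{W. open W \<and> emeasure \<mu> W = 0}" by (auto simp: supp_def)
  moreover have "open (\<Union>{W. open W \<and> emeasure \<mu> W = 0})" by (rule open_Union) simp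
  ultimately show "closed (supp \<mu>)" unfolding closed_def by simp
next
  fix g assume g: "g \<in> carrier G"
  show "\<phi> g ` supp \<mu> \<subseteq> supp \<mu>"
  proof (rule image_subsetI)
    fix x assume x: "x \<in> supp \<mu>"
    have "0 < emeasure \<mu> U" if U: "open U" "\<phi> g x \<in> U" for U
    proof -
      have "open (\<phi> g -` U)" using U(1) flow_continuous[OF flow g] open_vimage by blast
      then have "0 < emeasure \<mu> (\<phi> g -` U)" using x U(2) by (auto simp: supp_def)
      then show ?thesis using Prob_inv_vimage[OF flow \<mu> g] U(1) by simp
    qed
    then show "\<phi> g x \<in> supp \<mu>" by (simp add: supp_def)
  qed
qed

theorem proposition4p4:
  fixes G :: "('g, 'm) monoid_scheme"
    and \<phi> :: "'g \<Rightarrow> 'x::{t2_space, uniform_space} \<Rightarrow> 'x"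
    and \<mu> :: "'x measure"
  assumes "flow G \<phi>"
    and "tame G \<phi>"
    and "\<mu> \<in> Erg G \<phi>"
  shows "minimal_subflow G \<phi> (supp \<mu>)"
proof -
  note flow = \<open>flow G \<phi>\<close> and erg = \<open>\<mu> \<in> Erg G \<phi>\<close>
  interpret group G using flow by (rule flow_group)
  have \<mu>: "\<mu> \<in> Prob_inv G \<phi>" using erg by (simp add: Erg_def)
  then have reg: "regular_borel_prob \<mu>" by (simp add: Prob_inv_def)
  interpret prob_space \<mu> using reg regular_borel_probD by blast
  note [simp] = regular_borel_probD(2)[OF reg]
  define T where "T = \<phi> ` carrier G"
  have id_T: "id \<in> T"
    unfolding T_def using flow_one[OF flow] by (metis imageI one_closed)
  interpret tame_measure_group T \<mu>
  proof
    show "compact (UNIV :: 'x set)" by (rule flow.compact_phase_space[OF flow])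
    show "regular_borel_prob \<mu>" by (rule reg)
    show "continuous_on UNIV t" if "t \<in> T" for t
      using that flow_continuous[OF flow] by (auto simp: T_def)
    show "s \<circ> t \<in> T" if "s \<in> T" "t \<in> T" for s t
      using that flow_comp[OF flow] unfolding T_def by (metis (no_types, lifting) imageE imageI m_closed)
    show "\<exists>s\<in>T. t \<circ> s = id" if t: "t \<in> T" for t
    proof -
      obtain g where g: "g \<in> carrier G" "t = \<phi> g" using t by (auto simp: T_def)
      then have "t \<circ> \<phi> (inv\<^bsub>G\<^esub> g) = id"
        using flow_comp[OF flow, of g "inv\<^bsub>G\<^esub> g"] flow_one[OF flow] by simp
      then show ?thesis using g(1) unfolding T_def by blast
    qed
    show "distr \<mu> borel t = \<mu>" if "t \<in> T" for t
      using that \<mu> by (auto simp: T_def Prob_inv_def)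
    show "fragmented p" if "p \<in> closure T" for p
      using that \<open>tame G \<phi>\<close> by (simp add: tame_def enveloping_semigroup_def T_def)
  qed
  have "z \<in> closure (orbit G \<phi> y)" if y: "y \<in> supp \<mu>" and z: "z \<in> supp \<mu>" for y z
  proof (rule ccontr)
    assume "z \<notin> closure (orbit G \<phi> y)"
    then obtain f :: "'x \<Rightarrow> real" where f: "continuous_on UNIV f"
      "\<And>x. x \<in> closure (orbit G \<phi> y) \<Longrightarrow> f x = 0" "f z = 1"
      using compact_Urysohn[OF compact_space closed_closure] by blast
    have f_orbit: "f (t y) = 0" if "t \<in> T" for t
      using that f(2) closure_subset[of "orbit G \<phi> y"] by (auto simp: T_def orbit_def)
    have ft: "continuous_on UNIV (\<lambda>x. f (t x))" if "t \<in> T" for t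
      using continuous_on_compose2[OF f(1) continuous[OF that]] by simp
    define V where "V = {x. 1/2 < f x}"
    have "open V" unfolding V_def by (intro open_Collect_less continuous_intros f(1))
    then have "0 < emeasure \<mu> V" using z f(3) by (auto simp: supp_def V_def)
    then obtain CV where CV: "CV \<subseteq> T" "countable CV" "measure \<mu> (\<Union>t\<in>CV. t -` V) = 1"
      using Erg_countably_many_translates_cover[OF flow erg \<open>open V\<close>] unfolding T_def by blast
    define W where "W F = {x. \<forall>t\<in>F. f (t x) < 1/3}" for F :: "('x \<Rightarrow> 'x) set"
    have open_W: "open (W F)" if F: "finite F" "F \<subseteq> T" for F
    proof -
      have "open {x. f (t x) < 1/3}" if "t \<in> F" for t
        using F(2) that by (intro open_Collect_less continuous_on_const ft) auto
      moreover have "W F = (\<Inter>t\<in>F. {x. f (t x) < 1/3})" by (auto simp: W_def)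
      ultimately show ?thesis using F(1) by (simp add: open_INT)
    qed
    have "\<exists>C\<subseteq>T. countable C \<and> measure \<mu> (\<Union>t\<in>C. t -` W F) = 1" if F: "finite F" "F \<subseteq> T" for F
    proof -
      have "y \<in> W F" using f_orbit F(2) by (auto simp: W_def)
      then have "0 < emeasure \<mu> (W F)" using y open_W[OF F] by (auto simp: supp_def)
      then show ?thesis
        using Erg_countably_many_translates_cover[OF flow erg open_W[OF F]] unfolding T_def by blast
    qed
    then obtain C where C: "\<And>F. finite F \<Longrightarrow> F \<subseteq> T \<Longrightarrow>
        C F \<subseteq> T \<and> countable (C F) \<and> measure \<mu> (\<Union>t\<in>C F. t -` W F) = 1"
      by metis
    \<comment> \<open>\<open>CV\<close> and \<open>C F\<close> are absorbed into \<open>S\<close>, so that the orbit under \<open>S\<close> of almost every point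
      meets \<open>V\<close> and \<open>W F\<close> for all finite \<open>F \<subseteq> S\<close>.\<close>
    obtain S where S: "S \<subseteq> T" "countable S" "id \<in> S" "\<And>s t. s \<in> S \<Longrightarrow> t \<in> S \<Longrightarrow> s \<circ> t \<in> S"
      "\<And>F. finite F \<Longrightarrow> F \<subseteq> S \<Longrightarrow> CV \<union> C F \<subseteq> S"
    proof (rule countable_submonoid_closed_under[of T "\<lambda>F. CV \<union> C F", OF id_T comp_closed])
      show "countable (CV \<union> C F) \<and> CV \<union> C F \<subseteq> T" if "finite F" "F \<subseteq> T" for F
        using C[OF that] CV(1,2) by simp
    next
      fix S assume "S \<subseteq> T" "countable S" "id \<in> S" "\<And>s t. s \<in> S \<Longrightarrow> t \<in> S \<Longrightarrow> s \<circ> t \<in> S"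
        "\<And>F. finite F \<Longrightarrow> F \<subseteq> S \<Longrightarrow> CV \<union> C F \<subseteq> S"
      then show ?thesis by (rule that)
    qed
    \<comment> \<open>Minimality is with respect to \<open>S\<close>, but \<open>v\<close> and \<open>q\<close> are also limits of maps
      in \<open>T\<close>, so that tameness and invariance apply to them.\<close>
    obtain v q where v: "v \<in> closure S" "q \<in> closure S" "v \<circ> q = q"
      "\<And>x z. z \<in> closure ((\<lambda>t. t (v x)) ` S) \<Longrightarrow> v x \<in> closure ((\<lambda>t. t z) ` S)"
    proof (rule exists_minimal_limit[of S, OF compact_space])
      show "continuous_on UNIV t" if "t \<in> S" for t using that S(1) continuous by blast
      show "id \<in> S" by (rule S(3))
      show "s \<circ> t \<in> S" if "s \<in> S" "t \<in> S" for s t using that by (rule S(4))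
    next
      fix v q assume "v \<in> closure S" "q \<in> closure S" "v \<circ> q = q"
        "\<And>x z. z \<in> closure ((\<lambda>t. t (v x)) ` S) \<Longrightarrow> v x \<in> closure ((\<lambda>t. t z) ` S)"
      then show ?thesis by (rule that)
    qed
    have vq: "v \<in> closure T" "q \<in> closure T" using v(1,2) closure_mono[OF S(1)] by auto
    have AE_translates: "AE x in \<mu>. \<exists>t\<in>S. t x \<in> A" if "D \<subseteq> S" "measure \<mu> (\<Union>t\<in>D. t -` A) = 1" for A D
    proof -
      have "AE x in \<mu>. x \<in> (\<Union>t\<in>D. t -` A)" using that(2) by (rule AE_prob_1)
      then show ?thesis by eventually_elim (use that(1) in auto)
    qed
    have "AE x in \<mu>. \<exists>t\<in>S. t x \<in> V"
      by (rule AE_translates[OF _ CV(3)]) (use S(5)[of "{}"] in auto)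
    moreover have "AE x in \<mu>. \<forall>F\<in>{F. finite F \<and> F \<subseteq> S}. \<exists>s\<in>S. s x \<in> W F"
    proof (subst AE_ball_countable)
      show "countable {F. finite F \<and> F \<subseteq> S}"
        using countable_Collect_finite_subset[OF S(2)] by (simp add: conj_commute)
      show "\<forall>F\<in>{F. finite F \<and> F \<subseteq> S}. AE x in \<mu>. \<exists>s\<in>S. s x \<in> W F"
      proof
        fix F assume "F \<in> {F. finite F \<and> F \<subseteq> S}"
        then have F: "finite F" "F \<subseteq> S" "F \<subseteq> T" using S(1) by auto
        then show "AE x in \<mu>. \<exists>s\<in>S. s x \<in> W F"
          using AE_translates[of "C F" "W F"] C[OF F(1,3)] S(5)[OF F(1,2)] by simp
      qed
    qed
    moreover have "AE x in \<mu>. \<forall>t\<in>S. f (t (v x)) = f (t x)"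
    proof (subst AE_ball_countable[OF S(2)], rule ballI)
      fix t assume "t \<in> S"
      then show "AE x in \<mu>. f (t (v x)) = f (t x)"
        using left_identity_AE_eq[OF ft vq v(3)] S(1) by auto
    qed
    ultimately have "AE x in \<mu>. (\<exists>t\<in>S. t x \<in> V) \<and> (\<forall>F\<in>{F. finite F \<and> F \<subseteq> S}. \<exists>s\<in>S. s x \<in> W F) \<and>
        (\<forall>t\<in>S. f (t (v x)) = f (t x))"
      by eventually_elim blast
    from eventually_happens'[OF ae_filter_bot this]
    obtain x where x: "\<exists>t\<in>S. t x \<in> V" "\<forall>F\<in>{F. finite F \<and> F \<subseteq> S}. \<exists>s\<in>S. s x \<in> W F"
      "\<forall>t\<in>S. f (t (v x)) = f (t x)"
      by blast
    have closed_t: "closed {w. f (t w) \<le> 1/3}" if "t \<in> S" for t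
      using that S(1) by (intro closed_Collect_le continuous_on_const ft) auto
    \<comment> \<open>The orbit of \<open>v x\<close> imitates that of \<open>y\<close> along every finite part of \<open>S\<close>; in the limit
      a point imitates it along all of \<open>S\<close>.\<close>
    have "closure ((\<lambda>t. t (v x)) ` S) \<inter> (\<Inter>t\<in>S. {w. f (t w) \<le> 1/3}) \<noteq> {}"
    proof (rule compact_imp_fip_image)
      show "compact (closure ((\<lambda>t. t (v x)) ` S))"
        using compact_Int_closed[OF compact_space closed_closure] by simp
    next
      fix F assume F: "finite F" "F \<subseteq> S"
      then obtain s where s: "s \<in> S" "s x \<in> W F" using x(2) by blast
      have "f (t (s (v x))) \<le> 1/3" if "t \<in> F" for t
      proof -
        have "f (t (s (v x))) = f (t (s x))"
          using bspec[OF x(3) S(4)[of t s]] F(2) that s(1) by auto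
        then show ?thesis using s(2) that by (auto simp: W_def less_imp_le)
      qed
      moreover have "s (v x) \<in> closure ((\<lambda>t. t (v x)) ` S)" 
        using s(1) by (intro subsetD[OF closure_subset]) auto
      ultimately show "closure ((\<lambda>t. t (v x)) ` S) \<inter> (\<Inter>t\<in>F. {w. f (t w) \<le> 1/3}) \<noteq> {}" by blast
    qed (rule closed_t)
    then obtain w where w: "w \<in> closure ((\<lambda>t. t (v x)) ` S)" "\<forall>t\<in>S. f (t w) \<le> 1/3"
      by blast
    obtain t where t: "t \<in> S" "1/2 < f (t x)" using x(1) by (auto simp: V_def)
    have "(\<lambda>s. s w) ` S \<subseteq> {w. f (t w) \<le> 1/3}"
    proof (rule image_subsetI)
      fix s assume "s \<in> S"
      then show "s w \<in> {w. f (t w) \<le> 1/3}" using bspec[OF w(2) S(4)[OF t(1)]] by simp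
    qed
    then have "closure ((\<lambda>s. s w) ` S) \<subseteq> {w. f (t w) \<le> 1/3}"
      using closed_t[OF t(1)] by (rule closure_minimal)
    then have "f (t (v x)) \<le> 1/3" using v(4)[OF w(1)] by auto
    then show False using bspec[OF x(3) t(1)] t(2) by simp
  qed
  then show ?thesis
    using subflow_supp[OF flow \<mu>] unfolding minimal_subflow_def by blast
qed

end
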